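(* The $M$-vertex-stabilizer problem admits a polynomial-time 2-approximation algorithm. Furthermore, if $M$ is a maximum-weight matching of $G$, then the problem can be solved in polynomial time.
   Context: Given a finite simple undirected graph $G=(V,E)$ with edge weights $w\in\mathbb{R}^E_{\ge0}$ and a matching $M$ of $G$, an $M$-vertex-stabilizer is a set $S\subseteq V$ such that $G\setminus S:=G[V\setminus S]$ is stable and $M$ is a maximum-weight matching of $G\setminus S$. The $M$-vertex-stabilizer problem asks, given $(G,w,M)$, for an $M$-vertex-stabilizer of minimum cardinality (instances may have no $M$-vertex-stabilizer at all; such instances can be recognized). A weighted graph $H$ is stable if its maximum weight of a matching equals $\max\{w^\top x: x\ge 0,\ x(\delta(v))\le 1\ \forall v\}$, where $\delta(v)$ is the set of edges incident to $v$. *)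

theory Defs
  imports Complex_Main "HOL-Computational_Algebra.Polynomial"
begin

section \<open>Weighted graphs, matchings and stability\<close>

definition simple_graph :: "'a set \<Rightarrow> 'a set set \<Rightarrow> bool" where
  "simple_graph V E \<longleftrightarrow> finite V \<and> (\<forall>e\<in>E. e \<subseteq> V \<and> card e = 2)"

definition induced_edges :: "'a set set \<Rightarrow> 'a set \<Rightarrow> 'a set set" where
  "induced_edges E X = {e \<in> E. e \<subseteq> X}"

definition incident_edges :: "'a set set \<Rightarrow> 'a \<Rightarrow> 'a set set" where
  "incident_edges E v = {e \<in> E. v \<in> e}"

definition matching :: "'a set set \<Rightarrow> 'a set set \<Rightarrow> bool" where
  "matching E M \<longleftrightarrow> M \<subseteq> E \<and> (\<forall>e\<in>M. \<forall>f\<in>M. e \<noteq> f \<longrightarrow> e \<inter> f = {})"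

definition max_weight_matching ::
  "'a set set \<Rightarrow> ('a set \<Rightarrow> real) \<Rightarrow> 'a set set \<Rightarrow> bool" where
  "max_weight_matching E w M \<longleftrightarrow>
     matching E M \<and> (\<forall>N. matching E N \<longrightarrow> sum w N \<le> sum w M)"

definition matching_value :: "'a set set \<Rightarrow> ('a set \<Rightarrow> real) \<Rightarrow> real" where
  "matching_value E w = Max {sum w N | N. matching E N}"

definition fractional_matching ::
  "'a set \<Rightarrow> 'a set set \<Rightarrow> ('a set \<Rightarrow> real) \<Rightarrow> bool" where
  "fractional_matching V E x \<longleftrightarrow>
     (\<forall>e\<in>E. 0 \<le> x e) \<and> (\<forall>v\<in>V. (\<Sum>e\<in>incident_edges E v. x e) \<le> 1)"

text \<open>
  For a finite simple graph the feasible region (restricted to coordinates in \<open>E\<close>) is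
  nonempty and compact, so the supremum below is a maximum.
\<close>

definition fractional_matching_value ::
  "'a set \<Rightarrow> 'a set set \<Rightarrow> ('a set \<Rightarrow> real) \<Rightarrow> real" where
  "fractional_matching_value V E w =
     Sup {(\<Sum>e\<in>E. w e * x e) | x. fractional_matching V E x}"

definition stable :: "'a set \<Rightarrow> 'a set set \<Rightarrow> ('a set \<Rightarrow> real) \<Rightarrow> bool" where
  "stable V E w \<longleftrightarrow> matching_value E w = fractional_matching_value V E w"


section \<open>The vertex-stabilizer problem\<close>

definition stabilizer_instance ::
  "'a set \<Rightarrow> 'a set set \<Rightarrow> ('a set \<Rightarrow> real) \<Rightarrow> 'a set set \<Rightarrow> bool" where
  "stabilizer_instance V E w M \<longleftrightarrow>
     simple_graph V E \<and> (\<forall>e\<in>E. 0 \<le> w e) \<and> matching E M"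

definition vertex_stabilizer ::
  "'a set \<Rightarrow> 'a set set \<Rightarrow> ('a set \<Rightarrow> real) \<Rightarrow> 'a set set \<Rightarrow> 'a set \<Rightarrow> bool" where
  "vertex_stabilizer V E w M S \<longleftrightarrow>
     S \<subseteq> V \<and>
     stable (V - S) (induced_edges E (V - S)) w \<and>
     max_weight_matching (induced_edges E (V - S)) w M"

definition approx_stabilizer ::
  "nat \<Rightarrow> 'a set \<Rightarrow> 'a set set \<Rightarrow> ('a set \<Rightarrow> real) \<Rightarrow> 'a set set \<Rightarrow> 'a set \<Rightarrow> bool" where
  "approx_stabilizer \<alpha> V E w M S \<longleftrightarrow>
     vertex_stabilizer V E w M S \<and>
     (\<forall>S'. vertex_stabilizer V E w M S' \<longrightarrow> card S \<le> \<alpha> * card S')"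

definition min_stabilizer ::
  "'a set \<Rightarrow> 'a set set \<Rightarrow> ('a set \<Rightarrow> real) \<Rightarrow> 'a set set \<Rightarrow> 'a set \<Rightarrow> bool" where
  "min_stabilizer V E w M S \<longleftrightarrow>
     vertex_stabilizer V E w M S \<and>
     (\<forall>S'. vertex_stabilizer V E w M S' \<longrightarrow> card S \<le> card S')"


section \<open>Model of computation\<close>

text \<open>
  Since edge weights are real numbers, running time is measured on a random access machine
  with real registers, presented as a while language. A state holds named registers and named
  arrays of natural numbers (control, indices) and of reals. The arithmetic is restricted to
  addition, subtraction and comparison, and reals influence natural numbers only through
  comparisons. There is deliberately no multiplication (on either sort) and no rounding:
  a run of length \<open>t\<close> only produces numbers whose bit length exceeds that of the input by
  \<open>O(t)\<close>, so for rational weights a polynomial bound on the number of steps also bounds the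
  running time in the bit model polynomially.
\<close>

type_synonym name = string

record state =
  nvar :: "name \<Rightarrow> nat"
  narr :: "name \<Rightarrow> nat \<Rightarrow> nat"
  rvar :: "name \<Rightarrow> real"
  rarr :: "name \<Rightarrow> nat \<Rightarrow> real"

datatype nexp =
    NConst nat
  | NVar name
  | NArr name nexp
  | NPlus nexp nexp
  | NMinus nexp nexp

datatype rexp =
    RZero
  | RVar name
  | RArr name nexp
  | RPlus rexp rexp
  | RMinus rexp rexp

datatype bexp =
    NLess nexp nexp
  | RLess rexp rexp
  | BNot bexp
  | BAnd bexp bexp

datatype com =
    Skip
  | NAssign name nexp
  | NStore name nexp nexp
  | RAssign name rexp
  | RStore name nexp rexp
  | Seq com com
  | Cond bexp com com
  | While bexp com

fun nval :: "nexp \<Rightarrow> state \<Rightarrow> nat" where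
  "nval (NConst k) s = k"
| "nval (NVar x) s = nvar s x"
| "nval (NArr a i) s = narr s a (nval i s)"
| "nval (NPlus a b) s = nval a s + nval b s"
| "nval (NMinus a b) s = nval a s - nval b s"

fun rval :: "rexp \<Rightarrow> state \<Rightarrow> real" where
  "rval RZero s = 0"
| "rval (RVar x) s = rvar s x"
| "rval (RArr a i) s = rarr s a (nval i s)"
| "rval (RPlus a b) s = rval a s + rval b s"
| "rval (RMinus a b) s = rval a s - rval b s"

fun bval :: "bexp \<Rightarrow> state \<Rightarrow> bool" where
  "bval (NLess a b) s \<longleftrightarrow> nval a s < nval b s"
| "bval (RLess a b) s \<longleftrightarrow> rval a s < rval b s"
| "bval (BNot b) s \<longleftrightarrow> \<not> bval b s"
| "bval (BAnd a b) s \<longleftrightarrow> bval a s \<and> bval b s"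

text \<open>
  \<open>exec c s t s'\<close>: started in \<open>s\<close>, the program \<open>c\<close> halts in \<open>s'\<close> after exactly \<open>t\<close> steps.
  Every assignment and every evaluation of a test is one step; as the expressions are part of
  the fixed program, counting their individual operations would change the time by at most a
  constant factor depending on the program only.
\<close>

inductive exec :: "com \<Rightarrow> state \<Rightarrow> nat \<Rightarrow> state \<Rightarrow> bool" where
  Skip: "exec Skip s 1 s"
| NAssign: "exec (NAssign x a) s 1 (s\<lparr>nvar := (nvar s)(x := nval a s)\<rparr>)"
| NStore: "exec (NStore a i b) s 1
    (s\<lparr>narr := (narr s)(a := (narr s a)(nval i s := nval b s))\<rparr>)"
| RAssign: "exec (RAssign x a) s 1 (s\<lparr>rvar := (rvar s)(x := rval a s)\<rparr>)"
| RStore: "exec (RStore a i b) s 1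
    (s\<lparr>rarr := (rarr s)(a := (rarr s a)(nval i s := rval b s))\<rparr>)"
| Seq: "exec c s t s' \<Longrightarrow> exec d s' u s'' \<Longrightarrow> exec (Seq c d) s (t + u) s''"
| CondTrue: "bval b s \<Longrightarrow> exec c s t s' \<Longrightarrow> exec (Cond b c d) s (1 + t) s'"
| CondFalse: "\<not> bval b s \<Longrightarrow> exec d s t s' \<Longrightarrow> exec (Cond b c d) s (1 + t) s'"
| WhileFalse: "\<not> bval b s \<Longrightarrow> exec (While b c) s 1 s"
| WhileTrue: "bval b s \<Longrightarrow> exec c s t s' \<Longrightarrow> exec (While b c) s' u s'' \<Longrightarrow>
    exec (While b c) s (1 + t + u) s''"

inductive_cases SkipE: "exec Skip s t s'"
inductive_cases NAssignE: "exec (NAssign x a) s t s'"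
inductive_cases NStoreE: "exec (NStore a i b) s t s'"
inductive_cases RAssignE: "exec (RAssign x a) s t s'"
inductive_cases RStoreE: "exec (RStore a i b) s t s'"
inductive_cases SeqE: "exec (Seq c d) s t s'"
inductive_cases CondE: "exec (Cond b c d) s t s'"
inductive_cases WhileE: "exec (While b c) s t s'"

lemma exec_deterministic:
  "exec c s t s' \<Longrightarrow> exec c s u s'' \<Longrightarrow> u = t \<and> s'' = s'"
proof (induction arbitrary: u s'' rule: exec.induct)
  case (Skip s)
  then show ?case by (elim SkipE) simp
next
  case (NAssign x a s)
  then show ?case by (elim NAssignE) simp
next
  case (NStore a i b s)
  then show ?case by (elim NStoreE) simp
next
  case (RAssign x a s)
  then show ?case by (elim RAssignE) simp
next
  case (RStore a i b s)
  then show ?case by (elim RStoreE) simp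
next
  case (Seq c s t s' d t' s1)
  from Seq.prems show ?case by (rule SeqE) (metis Seq.IH)
next
  case (CondTrue b s c t s' d)
  from CondTrue.prems show ?case by (rule CondE) (use CondTrue.hyps(1) in \<open>auto dest: CondTrue.IH\<close>)
next
  case (CondFalse b s d t s' c)
  from CondFalse.prems show ?case by (rule CondE) (use CondFalse.hyps(1) in \<open>auto dest: CondFalse.IH\<close>)
next
  case (WhileFalse b s c)
  from WhileFalse.prems show ?case by (rule WhileE) (use WhileFalse.hyps in simp_all)
next
  case (WhileTrue b s c t s' t' s1)
  from WhileTrue.prems show ?case
    by (rule WhileE) (use WhileTrue.hyps(1) in \<open>auto dest: WhileTrue.IH\<close>)
qed

section \<open>Polynomial-time algorithms for the problem\<close>

text \<open>
  The vertex set is \<open>{..<n}\<close>. The graph is given as a list of its \<open>m\<close> edges, each occurring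
  once and in either orientation, in an arbitrary order; the \<open>k\<close>-th edge comes with its
  endpoints \<open>u[k]\<close> and \<open>v[k]\<close>, its weight \<open>w[k]\<close> and a flag \<open>M[k]\<close> telling whether it belongs
  to the matching. All other memory cells are initially \<open>0\<close>.
\<close>

definition encodes ::
  "state \<Rightarrow> nat \<Rightarrow> nat set set \<Rightarrow> (nat set \<Rightarrow> real) \<Rightarrow> nat set set \<Rightarrow> bool" where
  "encodes s n E w M \<longleftrightarrow>
     (\<exists>e. bij_betw e {..<card E} E \<and>
        (\<forall>k<card E.
           e k = {narr s ''u'' k, narr s ''v'' k} \<and>
           rarr s ''w'' k = w (e k) \<and>
           narr s ''M'' k = (if e k \<in> M then 1 else 0))) \<and>
     nvar s = (\<lambda>_. 0)(''n'' := n, ''m'' := card E) \<and>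
     rvar s = (\<lambda>_. 0) \<and>
     (\<forall>a k. a \<notin> {''u'', ''v'', ''M''} \<or> card E \<le> k \<longrightarrow> narr s a k = 0) \<and>
     (\<forall>a k. a \<noteq> ''w'' \<or> card E \<le> k \<longrightarrow> rarr s a k = 0)"

definition output_set :: "nat \<Rightarrow> state \<Rightarrow> nat set" where
  "output_set n s = {v. v < n \<and> narr s ''S'' v = 1}"

text \<open>
  The program \<open>c\<close> runs in polynomial time on all instances satisfying \<open>P\<close>. It reports in the
  register \<open>ok\<close> whether the instance has a stabilizer at all, and if so, the set it returns
  satisfies \<open>Q\<close>. The size of an instance is the number of vertices plus the number of edges.
\<close>

definition poly_time_algorithm ::
  "(nat set \<Rightarrow> nat set set \<Rightarrow> (nat set \<Rightarrow> real) \<Rightarrow> nat set set \<Rightarrow> bool) \<Rightarrow>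
   (nat set \<Rightarrow> nat set set \<Rightarrow> (nat set \<Rightarrow> real) \<Rightarrow> nat set set \<Rightarrow> nat set \<Rightarrow> bool) \<Rightarrow>
   com \<Rightarrow> bool" where
  "poly_time_algorithm P Q c \<longleftrightarrow>
     (\<exists>p :: nat poly. \<forall>n E w M s.
        stabilizer_instance {..<n} E w M \<and> P {..<n} E w M \<and> encodes s n E w M \<longrightarrow>
        (\<exists>t s'. exec c s t s' \<and> t \<le> poly p (n + card E) \<and>
           (if \<exists>S. vertex_stabilizer {..<n} E w M S
            then nvar s' ''ok'' = 1 \<and> Q {..<n} E w M (output_set n s')
            else nvar s' ''ok'' = 0)))"

end

theory Submission imports Defs begin

text \<open>
  A stabilizer consists of exposed vertices, and a set \<open>A\<close> of vertices containing all matched ones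
  may be kept iff \<open>M\<close> is a maximum-weight fractional matching of \<open>G[A]\<close>. By duality on the bipartite
  double cover this is a feasible system of difference constraints, so it fails iff there is an
  alternating walk of too large gain; the Bellman-Ford algorithm decides it with additions and
  comparisons only. A shortest violating walk meets exposed vertices at its ends only, hence a set
  of exposed vertices may be kept iff any two (possibly equal) of its members may be kept together.
  Stabilizers are therefore the vertex covers of a graph with loops on the exposed vertices.
  Covering the loops first and then taking both ends of every uncovered edge gives the factor 2.
  If \<open>M\<close> is a maximum-weight matching of \<open>G\<close>, then every edge is covered by the loops, as a
  shortest violating walk between two loopless vertices would be an augmenting path of \<open>M\<close>.
  So only the loop vertices, which lie in every stabilizer, are removed.
\<close>

section \<open>Duality and alternating walks\<close>

locale weighted_matching =
  fixes V :: "'a set" and E :: "'a set set" and w :: "'a set \<Rightarrow> real" and M :: "'a set set"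
  assumes inst: "stabilizer_instance V E w M"
begin

lemma finite_V: "finite V"
  and edge_subset: "e \<in> E \<Longrightarrow> e \<subseteq> V"
  and card_edge: "e \<in> E \<Longrightarrow> card e = 2"
  and weight_nonneg: "e \<in> E \<Longrightarrow> 0 \<le> w e"
  and M_subset: "M \<subseteq> E"
  and M_disjoint: "e \<in> M \<Longrightarrow> f \<in> M \<Longrightarrow> v \<in> e \<Longrightarrow> v \<in> f \<Longrightarrow> e = f"
  using inst unfolding stabilizer_instance_def simple_graph_def matching_def by blast+

lemma finite_E: "finite E"
  using finite_V edge_subset by (metis Pow_iff finite_Pow_iff rev_finite_subset subsetI)

lemma finite_M: "finite M"
  using finite_E M_subset finite_subset by blast

lemma edge_neq: "{u, v} \<in> E \<Longrightarrow> u \<noteq> v"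
  using card_edge by fastforce

definition mate :: "'a \<Rightarrow> 'a" where
  "mate v = (if v \<in> \<Union>M then (THE u. {v, u} \<in> M) else v)"

definition mweight :: "'a \<Rightarrow> real" where
  "mweight v = (if v \<in> \<Union>M then w {v, mate v} else 0)"

lemma mate_eq: assumes "{v, u} \<in> M" shows "mate v = u"
proof -
  have "(THE u. {v, u} \<in> M) = u"
  proof (rule the_equality, rule assms)
    fix x assume "{v, x} \<in> M"
    then have "{v, x} = {v, u}" using M_disjoint assms by blast
    then show "x = u" by (auto simp: doubleton_eq_iff)
  qed
  then show ?thesis using assms unfolding mate_def by auto
qed

lemma mate_edge: assumes "v \<in> \<Union>M" shows "{v, mate v} \<in> M"
proof -
  obtain e where e: "e \<in> M" "v \<in> e" using assms by blast
  then obtain a b where "e = {a, b}" using card_edge M_subset by (metis card_2_iff subsetD)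
  then obtain u where "e = {v, u}" using e by auto
  then show ?thesis using e mate_eq by metis
qed

lemma mate_exposed: "v \<notin> \<Union>M \<Longrightarrow> mate v = v"
  by (simp add: mate_def)

lemma mate_mate [simp]: "mate (mate v) = v"
  by (metis insert_commute mate_def mate_edge mate_eq)

lemma mate_neq: "v \<in> \<Union>M \<Longrightarrow> mate v \<noteq> v"
  using mate_edge M_subset edge_neq by fastforce

lemma mate_eq_self_iff: "mate v = v \<longleftrightarrow> v \<notin> \<Union>M"
  using mate_neq mate_exposed by blast

lemma mate_covered_iff [simp]: "mate v \<in> \<Union>M \<longleftrightarrow> v \<in> \<Union>M"
  by (metis mate_eq_self_iff mate_mate)

lemma mweight_mate [simp]: "mweight (mate v) = mweight v"
  unfolding mweight_def by (simp add: insert_commute del: Union_iff)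

lemma mweight_eq: "{v, u} \<in> M \<Longrightarrow> mweight v = w {v, u}"
  using mate_eq[of v u] by (auto simp: mweight_def)

lemma mweight_exposed: "v \<notin> \<Union>M \<Longrightarrow> mweight v = 0"
  by (simp add: mweight_def)

lemma covered_subset: "\<Union>M \<subseteq> V"
  using M_subset edge_subset by blast

text \<open>The dual linear program of the bipartite double cover, with the second copy
  \<open>q v = mweight v - p (mate v)\<close> eliminated: only difference constraints remain.\<close>

definition dual :: "'a set \<Rightarrow> ('a \<Rightarrow> real) \<Rightarrow> bool" where
  "dual A p \<longleftrightarrow> (\<forall>v\<in>A. 0 \<le> p v \<and> p v \<le> mweight v) \<and>
     (\<forall>u\<in>A. \<forall>v\<in>A. {u, v} \<in> E \<longrightarrow> p (mate v) + w {u, v} - mweight v \<le> p u)"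

text \<open>A walk \<open>x\<close> stands for the alternating walk
  \<open>x i, mate (x i), x (i + 1), mate (x (i + 1)), \<dots>, x j, mate (x j)\<close>.\<close>

definition walk :: "'a set \<Rightarrow> (nat \<Rightarrow> 'a) \<Rightarrow> nat \<Rightarrow> nat \<Rightarrow> bool" where
  "walk A x i j \<longleftrightarrow>
     (\<forall>k. i \<le> k \<and> k \<le> j \<longrightarrow> x k \<in> A) \<and> (\<forall>k. i \<le> k \<and> k < j \<longrightarrow> {mate (x k), x (Suc k)} \<in> E)"

definition gain :: "(nat \<Rightarrow> 'a) \<Rightarrow> nat \<Rightarrow> nat \<Rightarrow> real" where
  "gain x i j = (\<Sum>k=i..<j. w {mate (x k), x (Suc k)} - mweight (x k))"

lemma gain_refl [simp]: "gain x i i = 0"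
  by (simp add: gain_def)

lemma gain_Suc: "i \<le> j \<Longrightarrow> gain x i (Suc j) = gain x i j + w {mate (x j), x (Suc j)} - mweight (x j)"
  by (simp add: gain_def)

lemma gain_split: "i \<le> j \<Longrightarrow> j \<le> k \<Longrightarrow> gain x i k = gain x i j + gain x j k"
  by (simp add: gain_def sum.atLeastLessThan_concat)

lemma gain_shift: "gain (\<lambda>i. x (i + a)) i j = gain x (i + a) (j + a)"
  unfolding gain_def by (subst sum.shift_bounds_nat_ivl) simp

lemma gain_cong: "(\<And>k. i \<le> k \<Longrightarrow> k \<le> j \<Longrightarrow> x k = y k) \<Longrightarrow> gain x i j = gain y i j"
  unfolding gain_def by (intro sum.cong) auto

lemma mate_closed: "\<Union>M \<subseteq> A \<Longrightarrow> v \<in> A \<Longrightarrow> mate v \<in> A"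
  by (metis mate_covered_iff mate_exposed subsetD)

lemma walk_sub: "walk A x i t \<Longrightarrow> i \<le> j \<Longrightarrow> k \<le> t \<Longrightarrow> walk A x j k"
  by (auto simp: walk_def)

lemma walk_suffix: "walk A x 0 t \<Longrightarrow> i \<le> t \<Longrightarrow> walk A (\<lambda>k. x (k + i)) 0 (t - i)"
  by (auto simp: walk_def)

context
  fixes A assumes cov: "\<Union>M \<subseteq> A"
begin

lemma dual_forward:
  assumes "dual A p" "walk A x i j" "i \<le> j"
  shows "p (x i) + gain x i j \<le> p (x j)"
  using assms(3,2)
proof (induction j rule: dec_induct)
  case (step j)
  have "x (Suc j) \<in> A" "mate (x j) \<in> A" "{x (Suc j), mate (x j)} \<in> E"
    using step mate_closed[OF cov] by (auto simp: walk_def insert_commute)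
  then have "p (mate (mate (x j))) + w {x (Suc j), mate (x j)} - mweight (mate (x j)) \<le> p (x (Suc j))"
    using assms(1) unfolding dual_def by blast
  then show ?case using step by (simp add: walk_def gain_Suc insert_commute)
qed simp

lemma dual_backward:
  assumes "dual A p" "walk A x i j" "i \<le> j"
  shows "p (mate (x j)) + gain x i j + mweight (x i) \<le> p (mate (x i)) + mweight (x j)"
  using assms(3,2)
proof (induction j rule: dec_induct)
  case (step j)
  have "x (Suc j) \<in> A" "mate (x j) \<in> A" "{mate (x j), x (Suc j)} \<in> E"
    using step mate_closed[OF cov] by (auto simp: walk_def)
  then have "p (mate (x (Suc j))) + w {mate (x j), x (Suc j)} - mweight (x (Suc j)) \<le> p (mate (x j))"
    using assms(1) unfolding dual_def by blast
  then show ?case using step by (simp add: walk_def gain_Suc)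
qed simp

lemma walk_gain_le:
  assumes "dual A p" "walk A x 0 t" shows "gain x 0 t \<le> p (x t)"
proof -
  have "0 \<le> p (x 0)" using assms by (auto simp: dual_def walk_def)
  then show ?thesis using dual_forward[OF assms] by simp
qed

lemma walk_extend:
  assumes "walk A x 0 t" "{u, mate (x t)} \<in> E" "u \<in> A"
  shows "walk A (x(Suc t := u)) 0 (Suc t)"
    and "gain (x(Suc t := u)) 0 (Suc t) = gain x 0 t + w {u, mate (x t)} - mweight (x t)"
proof -
  have "gain (x(Suc t := u)) 0 t = gain x 0 t" by (intro gain_cong) simp
  then show "gain (x(Suc t := u)) 0 (Suc t) = gain x 0 t + w {u, mate (x t)} - mweight (x t)"
    by (simp add: gain_Suc insert_commute)
qed (use assms in \<open>auto simp: walk_def less_Suc_eq le_Suc_eq insert_commute\<close>)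

lemma dual_iff_walks:
  "(\<exists>p. dual A p) \<longleftrightarrow> (\<forall>x t. walk A x 0 t \<longrightarrow> gain x 0 t \<le> mweight (x t))"
proof
  assume "\<exists>p. dual A p"
  then obtain p where p: "dual A p" ..
  show "\<forall>x t. walk A x 0 t \<longrightarrow> gain x 0 t \<le> mweight (x t)"
  proof (intro allI impI)
    fix x t assume "walk A x 0 t"
    moreover from this have "p (x t) \<le> mweight (x t)" using p by (auto simp: dual_def walk_def)
    ultimately show "gain x 0 t \<le> mweight (x t)" using walk_gain_le[OF p] by fastforce
  qed
next
  assume *: "\<forall>x t. walk A x 0 t \<longrightarrow> gain x 0 t \<le> mweight (x t)"
  define G where "G v = {gain x 0 t |x t. walk A x 0 t \<and> x t = v}" for v
  have bdd: "bdd_above (G v)" for v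
    unfolding G_def by (rule bdd_aboveI[of _ "mweight v"]) (use * in blast)
  have z: "0 \<in> G v" if "v \<in> A" for v
    unfolding G_def using that by (auto simp: walk_def intro!: exI[of _ "\<lambda>_. v"] exI[of _ 0])
  have "dual A (\<lambda>v. Sup (G v))"
    unfolding dual_def
  proof (intro conjI ballI impI)
    fix v assume v: "v \<in> A"
    show "0 \<le> Sup (G v)" using cSup_upper[OF z[OF v] bdd] .
    show "Sup (G v) \<le> mweight v"
      by (rule cSup_least) (use z[OF v] * in \<open>auto simp: G_def\<close>)
  next
    fix u v assume uv: "u \<in> A" "v \<in> A" "{u, v} \<in> E"
    have "Sup (G (mate v)) \<le> Sup (G u) - w {u, v} + mweight v"
    proof (rule cSup_least)
      show "G (mate v) \<noteq> {}" using z mate_closed[OF cov uv(2)] by blast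
      fix g assume "g \<in> G (mate v)"
      then obtain x t where x: "g = gain x 0 t" "walk A x 0 t" "x t = mate v"
        unfolding G_def by blast
      have "g + w {u, v} - mweight v \<in> G u"
        unfolding G_def using walk_extend[OF x(2), of u] uv x
        by (intro CollectI exI[of _ "x(Suc t := u)"] exI[of _ "Suc t"]) simp
      from cSup_upper[OF this bdd] show "g \<le> Sup (G u) - w {u, v} + mweight v" by simp
    qed
    then show "Sup (G (mate v)) + w {u, v} - mweight v \<le> Sup (G u)" by simp
  qed
  then show "\<exists>p. dual A p" by (rule exI[of "dual A"])
qed

lemma walk_cut:
  assumes "walk A x 0 t" "i < j" "j \<le> t" "x i = x j"
  defines "y \<equiv> \<lambda>k. if k \<le> i then x k else x (k + (j - i))"
  shows "walk A y 0 (t - (j - i))" "y 0 = x 0" "y (t - (j - i)) = x t"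
    "gain y 0 (t - (j - i)) = gain x 0 t - gain x i j"
proof -
  have y: "y k = x (k + (j - i))" if "i \<le> k" for k
    using that assms by (cases "k = i") auto
  show "walk A y 0 (t - (j - i))"
    unfolding walk_def
  proof (intro conjI allI impI)
    fix k assume "0 \<le> k \<and> k \<le> t - (j - i)"
    then show "y k \<in> A" using assms(1-3) by (auto simp: walk_def y_def)
  next
    fix k assume k: "0 \<le> k \<and> k < t - (j - i)"
    show "{mate (y k), y (Suc k)} \<in> E"
    proof (cases "i \<le> k")
      case True then show ?thesis using y[of k] y[of "Suc k"] k assms(1-3) by (auto simp: walk_def)
    next
      case False then show ?thesis using k assms(1-3) by (auto simp: walk_def y_def)
    qed
  qed
  show "y 0 = x 0" by (simp add: y_def)
  show "y (t - (j - i)) = x t" using y[of "t - (j - i)"] assms(2,3) by simp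
  have "gain y 0 (t - (j - i)) = gain y 0 i + gain y i (t - (j - i))"
    using assms(2,3) by (intro gain_split) auto
  also have "gain y 0 i = gain x 0 i" by (intro gain_cong) (auto simp: y_def)
  also have "gain y i (t - (j - i)) = gain (\<lambda>k. x (k + (j - i))) i (t - (j - i))"
    by (intro gain_cong y)
  also have "\<dots> = gain x (i + (j - i)) (t - (j - i) + (j - i))" by (rule gain_shift)
  also have "\<dots> = gain x j t" using assms(2,3) by simp
  finally show "gain y 0 (t - (j - i)) = gain x 0 t - gain x i j"
    using gain_split[of 0 i t x] gain_split[of i j t x] assms(2,3) by simp
qed

lemma walk_shorten:
  assumes "dual A p" "A \<subseteq> V"
  shows "walk A x 0 t \<Longrightarrow> \<exists>y s. walk A y 0 s \<and> s \<le> card V \<and> y s = x t \<and> gain x 0 t \<le> gain y 0 s"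
proof (induction t arbitrary: x rule: less_induct)
  case (less t)
  show ?case
  proof (cases "t \<le> card V")
    case False
    have "x ` {..t} \<subseteq> V" using less.prems assms(2) by (auto simp: walk_def)
    then have "card (x ` {..t}) \<le> card V" by (simp add: card_mono finite_V)
    then have "\<not> inj_on x {..t}" using False by (auto dest: card_image)
    then obtain i j where ij: "i < j" "j \<le> t" "x i = x j"
      by (auto simp: inj_on_def) (metis nat_neq_iff)
    have "gain x i j \<le> 0" using dual_forward[OF assms(1) walk_sub[OF less.prems], of i j] ij by simp
    then show ?thesis
      using less.IH[OF _ walk_cut(1)[OF less.prems ij]] walk_cut(3,4)[OF less.prems ij] ij
      by fastforce
  qed (use less.prems in blast)
qed

end

subsection \<open>Stabilizers and dual solutions\<close>

lemma incident_matching_sum: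
  assumes "finite F" "N \<subseteq> F" "matching F N"
  shows "(\<Sum>e\<in>incident_edges F v. of_bool (e \<in> N) :: real) = of_bool (v \<in> \<Union>N)"
proof -
  have "(\<Sum>e\<in>incident_edges F v. of_bool (e \<in> N) :: real) = card {e \<in> N. v \<in> e}"
    using assms(1,2)
    by (auto simp: incident_edges_def of_bool_def sum.If_cases intro!: arg_cong[of _ _ card])
  also have "{e \<in> N. v \<in> e} = (if v \<in> \<Union>N then {SOME e. e \<in> N \<and> v \<in> e} else {})"
  proof (cases "v \<in> \<Union>N")
    case True
    then have "\<exists>e. e \<in> N \<and> v \<in> e" by blast
    from someI_ex[OF this] show ?thesis using True assms(3) unfolding matching_def by auto
  qed auto
  finally show ?thesis by simp
qed

lemma fractional_matching_of_matching:
  assumes "finite F" "matching F N"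
  shows "fractional_matching A F (\<lambda>e. of_bool (e \<in> N))"
  using incident_matching_sum[OF assms(1) _ assms(2)] assms(2)
  unfolding fractional_matching_def matching_def by simp

lemma sum_of_bool_mult: "finite F \<Longrightarrow> N \<subseteq> F \<Longrightarrow> (\<Sum>e\<in>F. w e * of_bool (e \<in> N)) = sum w N"
  by (simp add: of_bool_def sum.If_cases Int_absorb1 if_distrib[of "(*) _"] cong: if_cong)

lemma finite_induced: "finite (induced_edges E A)"
  using finite_E by (simp add: induced_edges_def)

lemma sum_mweight:
  assumes "\<Union>M \<subseteq> A" "A \<subseteq> V"
  shows "(\<Sum>v\<in>A. mweight v) = 2 * sum w M"
proof -
  have "(\<Sum>v\<in>A. mweight v) = (\<Sum>v\<in>\<Union>M. mweight v)"
    by (rule sum.mono_neutral_right) (use assms finite_V mweight_exposed finite_subset in auto)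
  also have "\<dots> = (\<Sum>e\<in>M. \<Sum>v\<in>e. mweight v)"
  proof -
    have "\<forall>e\<in>M. finite e" using M_subset edge_subset finite_V finite_subset by blast
    moreover have "\<forall>e\<in>M. \<forall>f\<in>M. e \<noteq> f \<longrightarrow> e \<inter> f = {}" using M_disjoint by blast
    ultimately show ?thesis by (simp add: sum.Union_disjoint)
  qed
  also have "\<dots> = (\<Sum>e\<in>M. 2 * w e)"
  proof (rule sum.cong)
    fix e assume e: "e \<in> M"
    then have "mweight v = w e" if "v \<in> e" for v
      using that mate_edge[of v] M_disjoint[of e "{v, mate v}" v] by (auto simp: mweight_def)
    then show "(\<Sum>v\<in>e. mweight v) = 2 * w e"
      using card_edge M_subset e by auto
  qed simp
  finally show ?thesis by (simp add: sum_distrib_left)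
qed

lemma weak_duality:
  assumes "\<Union>M \<subseteq> A" "A \<subseteq> V" "dual A p" "fractional_matching A (induced_edges E A) z"
  shows "(\<Sum>e\<in>induced_edges E A. w e * z e) \<le> sum w M"
proof -
  let ?F = "induced_edges E A"
  have finA: "finite A" using assms(2) finite_V finite_subset by blast
  define y where "y v = (p v + mweight v - p (mate v)) / 2" for v
  have y0: "0 \<le> y v" if "v \<in> A" for v
  proof -
    have "0 \<le> p v" "p (mate v) \<le> mweight (mate v)"
      using assms(3) that mate_closed[OF assms(1) that] by (auto simp: dual_def)
    then show ?thesis by (simp add: y_def)
  qed
  have cover: "w e \<le> (\<Sum>v\<in>e. y v)" if e: "e \<in> ?F" for e
  proof -
    obtain a b where ab: "e = {a, b}" "a \<noteq> b"
      using e card_edge by (metis (no_types, lifting) card_2_iff induced_edges_def mem_Collect_eq)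
    have "p (mate b) + w {a, b} - mweight b \<le> p a" "p (mate a) + w {b, a} - mweight a \<le> p b"
      using assms(3) e ab unfolding dual_def induced_edges_def by (auto simp: insert_commute)
    then show ?thesis using ab by (simp add: y_def insert_commute field_simps)
  qed
  have "(\<Sum>e\<in>?F. w e * z e) \<le> (\<Sum>e\<in>?F. (\<Sum>v\<in>e. y v) * z e)"
    using cover assms(4) by (intro sum_mono mult_right_mono) (auto simp: fractional_matching_def)
  also have "\<dots> = (\<Sum>e\<in>?F. \<Sum>v\<in>A. if v \<in> e then y v * z e else 0)"
  proof (rule sum.cong)
    fix e assume "e \<in> ?F"
    then have "A \<inter> e = e" by (auto simp: induced_edges_def)
    then show "(\<Sum>v\<in>e. y v) * z e = (\<Sum>v\<in>A. if v \<in> e then y v * z e else 0)"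
      using finA by (simp add: sum.inter_restrict[symmetric] sum_distrib_right)
  qed simp
  also have "\<dots> = (\<Sum>v\<in>A. \<Sum>e\<in>?F. if v \<in> e then y v * z e else 0)"
    by (rule sum.swap)
  also have "\<dots> = (\<Sum>v\<in>A. y v * (\<Sum>e\<in>incident_edges ?F v. z e))"
    by (simp add: incident_edges_def sum_distrib_left finite_induced sum.inter_filter
        if_distrib[of "(*) _"] cong: if_cong)
  also have "\<dots> \<le> (\<Sum>v\<in>A. y v * 1)"
    using y0 assms(4) by (intro sum_mono mult_left_mono) (auto simp: fractional_matching_def)
  also have "\<dots> = ((\<Sum>v\<in>A. p v) + (\<Sum>v\<in>A. mweight v) - (\<Sum>v\<in>A. p (mate v))) / 2"
    by (simp add: y_def sum.distrib sum_subtractf sum_divide_distrib[symmetric])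
  also have "(\<Sum>v\<in>A. p (mate v)) = (\<Sum>v\<in>A. p v)"
    by (rule sum.reindex_bij_witness[of _ mate mate]) (use mate_closed[OF assms(1)] in auto)
  finally show ?thesis using sum_mweight[OF assms(1,2)] by simp
qed

lemma augmenting_walk:
  assumes cov: "\<Union>M \<subseteq> A" and "A \<subseteq> V" and walk: "walk A x 0 t" and viol: "mweight (x t) < gain x 0 t"
  shows "\<exists>z. fractional_matching A (induced_edges E A) z \<and>
    sum w M < (\<Sum>e\<in>induced_edges E A. w e * z e)"
proof -
  let ?F = "induced_edges E A"
  define f where "f i = {mate (x i), x (Suc i)}" for i
  define g where "g i = {x i, mate (x i)}" for i
  define C where "C = {i. i \<le> t \<and> x i \<in> \<Union>M}"
  define \<epsilon> where "\<epsilon> = 1 / real (Suc t)"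
  define up where "up e = (\<Sum>i<t. of_bool (f i = e) :: real)" for e
  define down where "down e = (\<Sum>i\<in>C. of_bool (g i = e) :: real)" for e
  define z where "z e = of_bool (e \<in> M) + \<epsilon> * (up e - down e)" for e
  have finC: "finite C" "card C \<le> Suc t"
    unfolding C_def by (simp, rule order_trans[OF card_mono[of "{..t}"]]) auto
  have \<epsilon>: "0 < \<epsilon>" "\<epsilon> * real (Suc t) = 1" by (simp_all add: \<epsilon>_def)
  have MF: "M \<subseteq> ?F" using cov M_subset by (auto simp: induced_edges_def)
  have fF: "f i \<in> ?F" if "i < t" for i
    using walk that mate_closed[OF cov] by (auto simp: walk_def induced_edges_def f_def)
  have gM: "g i \<in> M" if "i \<in> C" for i
    using that mate_edge by (auto simp: C_def g_def)
  have matM: "matching ?F M" using inst MF by (auto simp: stabilizer_instance_def matching_def)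
  have sum_up: "(\<Sum>e\<in>D. h e * up e) = (\<Sum>i<t. h (f i) * of_bool (f i \<in> D))" if "finite D" for D h
    unfolding up_def sum_distrib_left
    by (subst sum.swap) (use that in \<open>auto intro!: sum.cong simp: of_bool_def if_distrib[of "(*) _"] cong: if_cong\<close>)
  have sum_down: "(\<Sum>e\<in>D. h e * down e) = (\<Sum>i\<in>C. h (g i) * of_bool (g i \<in> D))" if "finite D" for D h
    unfolding down_def sum_distrib_left
    by (subst sum.swap) (use that in \<open>auto intro!: sum.cong simp: of_bool_def if_distrib[of "(*) _"] cong: if_cong\<close>)
  have nonneg: "0 \<le> z e" for e
  proof (cases "e \<in> M")
    case True
    have "down e \<le> (\<Sum>i\<in>C. 1)" unfolding down_def by (intro sum_mono) simp
    also have "\<dots> \<le> real (Suc t)" using finC by simp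
    finally have "\<epsilon> * down e \<le> 1" using \<epsilon> by (metis less_imp_le mult_left_mono)
    moreover have "0 \<le> \<epsilon> * up e" using \<epsilon> by (simp add: up_def sum_nonneg)
    ultimately show ?thesis using True by (simp add: z_def right_diff_distrib)
  next
    case False
    then have "down e = 0" unfolding down_def using gM by (intro sum.neutral) auto
    moreover have "0 \<le> \<epsilon> * up e" using \<epsilon> by (simp add: up_def sum_nonneg)
    ultimately show ?thesis using False by (simp add: z_def)
  qed
  have degree: "(\<Sum>e\<in>incident_edges ?F v. z e) \<le> 1" if v: "v \<in> A" for v
  proof -
    let ?D = "incident_edges ?F v"
    have finD: "finite ?D" using finite_induced by (simp add: incident_edges_def)
    have up: "(\<Sum>e\<in>?D. up e) = (\<Sum>i<t. of_bool (v \<in> f i))"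
      using sum_up[OF finD, of "\<lambda>_. 1"] fF by (simp add: incident_edges_def)
    have down: "(\<Sum>e\<in>?D. down e) = (\<Sum>i\<in>C. of_bool (v \<in> g i))"
      using sum_down[OF finD, of "\<lambda>_. 1"] subsetD[OF MF gM]
      by (simp add: incident_edges_def cong: sum.cong)
    have total: "(\<Sum>e\<in>?D. z e) = of_bool (v \<in> \<Union>M) + \<epsilon> * ((\<Sum>e\<in>?D. up e) - (\<Sum>e\<in>?D. down e))"
      using incident_matching_sum[OF finite_induced MF matM, of v]
      by (simp add: z_def sum.distrib sum_distrib_left[symmetric] sum_subtractf)
    show ?thesis
    proof (cases "v \<in> \<Union>M")
      case True
      have "(\<Sum>i<t. of_bool (v \<in> f i) :: real)
          \<le> (\<Sum>i<t. of_bool (v = mate (x i)) + of_bool (v = x (Suc i)))"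
        by (intro sum_mono) (auto simp: f_def)
      also have "\<dots> = (\<Sum>i<t. of_bool (v = mate (x i))) + (\<Sum>i<t. of_bool (v = x (Suc i)))"
        by (rule sum.distrib)
      also have "(\<Sum>i<t. of_bool (v = mate (x i))) \<le> (\<Sum>i\<le>t. of_bool (v = mate (x i)) :: real)"
        by (intro sum_mono2) auto
      also have "(\<Sum>i<t. of_bool (v = x (Suc i))) \<le> (\<Sum>i\<le>t. of_bool (v = x i) :: real)"
        by (simp add: lessThan_Suc_atMost[symmetric] sum.lessThan_Suc_shift del: sum.lessThan_Suc)
      also have "(\<Sum>i\<le>t. of_bool (v = mate (x i)) :: real) + (\<Sum>i\<le>t. of_bool (v = x i))
          = (\<Sum>i\<le>t. of_bool (i \<in> C \<and> v \<in> g i))"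
        unfolding sum.distrib[symmetric]
      proof (rule sum.cong)
        fix i assume i: "i \<in> {..t}"
        show "of_bool (v = mate (x i)) + of_bool (v = x i) = (of_bool (i \<in> C \<and> v \<in> g i) :: real)"
        proof (cases "x i \<in> \<Union>M")
          case True
          then show ?thesis using i mate_neq[OF True] by (auto simp: C_def g_def simp del: Union_iff)
        next
          case False
          then have "v \<noteq> x i" using \<open>v \<in> \<Union>M\<close> by blast
          then show ?thesis using False mate_exposed[OF False] by (simp add: C_def del: Union_iff)
        qed
      qed simp
      also have "\<dots> = (\<Sum>i\<in>C. of_bool (v \<in> g i))"
        by (rule sum.mono_neutral_cong_right) (auto simp: C_def)
      finally have "(\<Sum>e\<in>?D. up e) - (\<Sum>e\<in>?D. down e) \<le> 0" using up down by simp
      then have "\<epsilon> * ((\<Sum>e\<in>?D. up e) - (\<Sum>e\<in>?D. down e)) \<le> 0"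
        using \<epsilon> by (simp add: mult_nonneg_nonpos)
      then show ?thesis using total True by simp
    next
      case False
      have "(\<Sum>e\<in>?D. up e) \<le> (\<Sum>i<t. 1)" unfolding up by (intro sum_mono) simp
      moreover have "0 \<le> (\<Sum>e\<in>?D. down e)" unfolding down by (simp add: sum_nonneg)
      ultimately have "(\<Sum>e\<in>?D. up e) - (\<Sum>e\<in>?D. down e) \<le> real (Suc t)" by simp
      then have "\<epsilon> * ((\<Sum>e\<in>?D. up e) - (\<Sum>e\<in>?D. down e)) \<le> 1"
        using \<epsilon> by (metis less_imp_le mult_left_mono)
      then show ?thesis using total False by simp
    qed
  qed
  have "(\<Sum>e\<in>?F. w e * z e) = (\<Sum>e\<in>?F. w e * of_bool (e \<in> M) + \<epsilon> * (w e * up e - w e * down e))"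
    by (intro sum.cong) (simp_all add: z_def algebra_simps)
  also have "\<dots> = sum w M + \<epsilon> * ((\<Sum>e\<in>?F. w e * up e) - (\<Sum>e\<in>?F. w e * down e))"
    by (simp only: sum.distrib sum_subtractf sum_distrib_left[symmetric] sum_of_bool_mult[OF finite_induced MF])
  also have "(\<Sum>e\<in>?F. w e * up e) = (\<Sum>i<t. w (f i))"
    unfolding sum_up[OF finite_induced] by (intro sum.cong) (simp_all add: fF)
  also have "(\<Sum>e\<in>?F. w e * down e) = (\<Sum>i\<in>C. w (g i))"
    unfolding sum_down[OF finite_induced] using subsetD[OF MF gM] by (intro sum.cong) simp_all
  also have "(\<Sum>i\<in>C. w (g i)) = (\<Sum>i\<le>t. mweight (x i))"
    by (rule sum.mono_neutral_cong_left) (auto simp: C_def g_def mweight_def)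
  also have "(\<Sum>i<t. w (f i)) = gain x 0 t + (\<Sum>i<t. mweight (x i))"
    unfolding gain_def f_def by (simp add: sum_subtractf atLeast0LessThan)
  also have "(\<Sum>i\<le>t. mweight (x i)) = (\<Sum>i<t. mweight (x i)) + mweight (x t)"
    by (simp add: lessThan_Suc_atMost[symmetric])
  finally have "(\<Sum>e\<in>?F. w e * z e) = sum w M + \<epsilon> * (gain x 0 t - mweight (x t))" by simp
  then show ?thesis
    using nonneg degree \<epsilon> viol by (intro exI[of _ z]) (auto simp: fractional_matching_def)
qed

lemma vertex_stabilizer_iff:
  "vertex_stabilizer V E w M S \<longleftrightarrow> S \<subseteq> V \<and> S \<inter> \<Union>M = {} \<and> (\<exists>p. dual (V - S) p)"
proof -
  let ?A = "V - S"
  let ?F = "induced_edges E ?A"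
  let ?frac = "{(\<Sum>e\<in>?F. w e * z e) |z. fractional_matching ?A ?F z}"
  let ?int = "{sum w N |N. matching ?F N}"
  have "?int \<subseteq> sum w ` Pow ?F" by (auto simp: matching_def)
  then have fin: "finite ?int" using finite_induced finite_subset by blast
  have value_eq: "matching_value ?F w = sum w M" if "max_weight_matching ?F w M"
    unfolding matching_value_def
  proof (rule Max_eqI[OF fin])
    show "sum w M \<in> ?int" using that unfolding max_weight_matching_def by blast
  qed (use that in \<open>auto simp: max_weight_matching_def\<close>)
  have M_sub: "\<Union>M \<subseteq> ?A \<and> matching ?F M" if "S \<inter> \<Union>M = {}"
  proof
    show "\<Union>M \<subseteq> ?A" using that covered_subset by blast
    then have "M \<subseteq> ?F" using M_subset unfolding induced_edges_def by blast
    then show "matching ?F M" using inst by (simp add: stabilizer_instance_def matching_def)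
  qed
  show ?thesis
  proof
    assume L: "vertex_stabilizer V E w M S"
    then have SV: "S \<subseteq> V" and st: "stable ?A ?F w" and mx: "max_weight_matching ?F w M"
      unfolding vertex_stabilizer_def by blast+
    have disj: "S \<inter> \<Union>M = {}"
      using mx unfolding max_weight_matching_def matching_def induced_edges_def by blast
    note cov = M_sub[OF disj, THEN conjunct1]
    have "bdd_above ?frac"
    proof (rule bdd_aboveI)
      fix a assume "a \<in> ?frac"
      then obtain z where z: "a = (\<Sum>e\<in>?F. w e * z e)" "fractional_matching ?A ?F z" by blast
      have "z e \<le> 1" if e: "e \<in> ?F" for e
      proof -
        obtain v where v: "v \<in> e" "v \<in> ?A"
          using e card_edge[of e] by (cases "e = {}") (auto simp: induced_edges_def)
        have "z e \<le> (\<Sum>e\<in>incident_edges ?F v. z e)"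
          using e v z(2) finite_induced
          by (intro member_le_sum) (auto simp: incident_edges_def fractional_matching_def)
        also have "\<dots> \<le> 1" using z(2) v(2) by (simp add: fractional_matching_def)
        finally show ?thesis .
      qed
      then show "a \<le> sum w ?F"
        unfolding z(1) using weight_nonneg
        by (intro sum_mono mult_left_le) (auto simp: induced_edges_def)
    qed
    then have le: "(\<Sum>e\<in>?F. w e * z e) \<le> sum w M" if "fractional_matching ?A ?F z" for z
      using st value_eq[OF mx] that cSup_upper[of _ ?frac]
      unfolding stable_def fractional_matching_value_def by auto
    have "gain x 0 t \<le> mweight (x t)" if "walk ?A x 0 t" for x t
      using augmenting_walk[OF cov _ that] le by force
    then show "S \<subseteq> V \<and> S \<inter> \<Union>M = {} \<and> (\<exists>p. dual ?A p)"
      using SV disj dual_iff_walks[OF cov] by blast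
  next
    assume R: "S \<subseteq> V \<and> S \<inter> \<Union>M = {} \<and> (\<exists>p. dual ?A p)"
    then obtain p where p: "dual ?A p" by blast
    have cov: "\<Union>M \<subseteq> ?A" and mat: "matching ?F M" using M_sub R by blast+
    have le: "(\<Sum>e\<in>?F. w e * z e) \<le> sum w M" if "fractional_matching ?A ?F z" for z
      using weak_duality[OF cov _ p that] by blast
    have mx: "max_weight_matching ?F w M"
      unfolding max_weight_matching_def
    proof (intro conjI allI impI mat)
      fix N assume N: "matching ?F N"
      then show "sum w N \<le> sum w M"
        using le[OF fractional_matching_of_matching[OF finite_induced N]]
          sum_of_bool_mult[OF finite_induced] by (simp add: matching_def)
    qed
    have "fractional_matching_value ?A ?F w = sum w M"
      unfolding fractional_matching_value_def
    proof (rule cSup_eq_maximum)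
      have "sum w M = (\<Sum>e\<in>?F. w e * of_bool (e \<in> M))"
        using sum_of_bool_mult[OF finite_induced] mat by (simp add: matching_def)
      then show "sum w M \<in> ?frac"
        using fractional_matching_of_matching[OF finite_induced mat]
        by (intro CollectI exI[of _ "\<lambda>e. of_bool (e \<in> M)"]) simp
    qed (use le in blast)
    then show "vertex_stabilizer V E w M S"
      using R mx value_eq[OF mx] by (auto simp: vertex_stabilizer_def stable_def)
  qed
qed

subsection \<open>Conflicts between exposed vertices\<close>

definition good :: "'a set \<Rightarrow> bool" where
  "good K \<longleftrightarrow> (\<exists>p. dual (\<Union>M \<union> K) p)"

lemma dual_mono: "dual A p \<Longrightarrow> B \<subseteq> A \<Longrightarrow> dual B p"
  unfolding dual_def by blast

lemma good_mono: "good K \<Longrightarrow> L \<subseteq> K \<Longrightarrow> good L"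
  unfolding good_def using dual_mono[of "\<Union>M \<union> K" _ "\<Union>M \<union> L"] by (meson Un_mono order_refl)

lemma good_walk: "good K \<Longrightarrow> walk (\<Union>M \<union> K) x 0 t \<Longrightarrow> gain x 0 t \<le> mweight (x t)"
  using dual_iff_walks[of "\<Union>M \<union> K"] unfolding good_def by simp

text \<open>A shortest violating walk meets exposed vertices at its ends only: one of the two parts
  of a violating walk split at an exposed vertex is violating.\<close>

lemma shortest_violating_walk:
  assumes "\<not> good K"
  obtains x t where "walk (\<Union>M \<union> K) x 0 t" "mweight (x t) < gain x 0 t"
    "\<And>y s. walk (\<Union>M \<union> K) y 0 s \<Longrightarrow> mweight (y s) < gain y 0 s \<Longrightarrow> t \<le> s"
    "\<And>i. 0 < i \<Longrightarrow> i < t \<Longrightarrow> x i \<in> \<Union>M"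
proof -
  let ?A = "\<Union>M \<union> K"
  let ?P = "\<lambda>t. \<exists>x. walk ?A x 0 t \<and> mweight (x t) < gain x 0 t"
  have "\<exists>t. ?P t"
    using assms dual_iff_walks[of ?A] unfolding good_def by (auto simp: not_le)
  then obtain t where t: "?P t" "\<And>s. s < t \<Longrightarrow> \<not> ?P s"
    using exists_least_iff[of ?P] by blast
  then obtain x where x: "walk ?A x 0 t" "mweight (x t) < gain x 0 t" by blast
  show thesis
  proof (rule that[OF x])
    fix i assume i: "0 < i" "i < t"
    show "x i \<in> \<Union>M"
    proof (rule ccontr)
      assume "x i \<notin> \<Union>M"
      then have z: "mweight (x i) = 0" by (rule mweight_exposed)
      have "gain x 0 i \<le> mweight (x i)"
        using t(2)[OF i(2)] walk_sub[OF x(1), of 0 i] i by force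
      moreover have "gain (\<lambda>k. x (k + i)) 0 (t - i) \<le> mweight (x (t - i + i))"
        using t(2)[of "t - i"] walk_suffix[OF x(1), of i] i by force
      then have "gain x i t \<le> mweight (x t)" using gain_shift[of x i 0 "t - i"] i by simp
      ultimately show False using z gain_split[of 0 i t x] i x(2) by simp
    qed
  next
    fix y s assume "walk ?A y 0 s" "mweight (y s) < gain y 0 s"
    then show "t \<le> s" using t(2)[of s] by (cases "s < t") auto
  qed
qed

lemma good_if_pairs_good:
  assumes "good {}" "\<And>a b. a \<in> K \<Longrightarrow> b \<in> K \<Longrightarrow> good {a, b}"
  shows "good K"
proof (rule ccontr)
  assume "\<not> good K"
  then obtain x t where x: "walk (\<Union>M \<union> K) x 0 t" "mweight (x t) < gain x 0 t"
    and cov: "\<And>i. 0 < i \<Longrightarrow> i < t \<Longrightarrow> x i \<in> \<Union>M"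
    by (rule shortest_violating_walk) blast
  have "good ({x 0, x t} \<inter> K)"
    using assms(2)[of "x 0" "x t"] assms(2)[of "x 0" "x 0"] assms(2)[of "x t" "x t"] assms(1)
    by (cases "x 0 \<in> K"; cases "x t \<in> K") simp_all
  moreover have "x i \<in> \<Union>M \<union> ({x 0, x t} \<inter> K)" if "i \<le> t" for i
    using that x(1) cov[of i] by (cases "i = 0 \<or> i = t") (auto simp: walk_def)
  then have "walk (\<Union>M \<union> ({x 0, x t} \<inter> K)) x 0 t" using x(1) by (simp add: walk_def)
  ultimately show False using good_walk x(2) by fastforce
qed

text \<open>If \<open>x j = mate (x i)\<close> for \<open>i < j\<close>, then the walk from \<open>x 0\<close> to \<open>x j\<close> followed by the reverse
  of its part up to \<open>x i\<close> is a flower at \<open>x 0\<close>, and there is one at \<open>x t\<close> likewise. Their gains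
  add up to twice the gain of the walk, so one of them is augmenting.\<close>

lemma no_flower:
  assumes x: "walk (\<Union>M \<union> {x 0, x t}) x 0 t" and "0 < gain x 0 t"
    and ends: "x 0 \<notin> \<Union>M" "x t \<notin> \<Union>M" "good {x 0}" "good {x t}"
    and cov: "\<And>i. 0 < i \<Longrightarrow> i < t \<Longrightarrow> x i \<in> \<Union>M"
    and ij: "0 < i" "i < j" "j < t"
  shows "x j \<noteq> mate (x i)"
proof
  assume m: "x j = mate (x i)"
  note m0 = mweight_exposed[OF ends(1)] mweight_exposed[OF ends(2)]
    mate_exposed[OF ends(1)] mate_exposed[OF ends(2)]
  obtain p where p: "dual (\<Union>M \<union> {x 0}) p" using ends good_def by blast
  obtain q where q: "dual (\<Union>M \<union> {x t}) q" using ends good_def by blast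
  have p0: "p (x 0) = 0" and q0: "q (x t) = 0"
    using p q m0 by (auto simp: dual_def intro: antisym)
  have "x k \<in> \<Union>M \<union> {x 0}" if "k \<le> j" for k
    using cov[of k] that ij by (cases "k = 0") auto
  then have w1: "walk (\<Union>M \<union> {x 0}) x 0 j" using x ij by (simp add: walk_def)
  have "x k \<in> \<Union>M \<union> {x t}" if "i \<le> k" "k \<le> t" for k
    using cov[of k] that ij by (cases "k = t") auto
  then have w2: "walk (\<Union>M \<union> {x t}) x i t" using x ij by (simp add: walk_def)
  have "p (x 0) + gain x 0 i \<le> p (x i)" "p (x i) + gain x i j \<le> p (x j)"
    using dual_forward[OF Un_upper1 p walk_sub[OF w1]] ij by auto
  moreover have "p (mate (x i)) + gain x 0 i + mweight (x 0) \<le> p (mate (x 0)) + mweight (x i)"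
    using dual_backward[OF Un_upper1 p walk_sub[OF w1]] ij by auto
  moreover have "q (x j) + gain x j t \<le> q (x t)" "q (x i) + gain x i j \<le> q (x j)"
    using dual_forward[OF Un_upper1 q walk_sub[OF w2]] ij by auto
  moreover have "q (mate (x t)) + gain x j t + mweight (x j) \<le> q (mate (x j)) + mweight (x t)"
    using dual_backward[OF Un_upper1 q walk_sub[OF w2]] ij by auto
  moreover have "gain x 0 t = gain x 0 i + gain x i j + gain x j t"
    using gain_split[of 0 i t x] gain_split[of i j t x] ij by simp
  ultimately show False
    using assms(2) m m0 p0 q0 by simp
qed

lemma augmenting_path:
  assumes edges: "\<And>i. i < t \<Longrightarrow> {mate (x i), x (Suc i)} \<in> E" and "0 < gain x 0 t"
    and ends: "x 0 \<notin> \<Union>M" "x t \<notin> \<Union>M" and cov: "\<And>i. 0 < i \<Longrightarrow> i < t \<Longrightarrow> x i \<in> \<Union>M"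
    and inj: "\<And>i j. i \<le> t \<Longrightarrow> j \<le> t \<Longrightarrow> i \<noteq> j \<Longrightarrow> x i \<noteq> x j"
    and mate: "\<And>i j. i \<le> t \<Longrightarrow> j \<le> t \<Longrightarrow> i \<noteq> j \<Longrightarrow> mate (x i) \<noteq> x j"
  shows "\<not> max_weight_matching E w M"
proof -
  define f where "f i = {mate (x i), x (Suc i)}" for i
  define g where "g i = {x i, mate (x i)}" for i
  define D where "D = g ` {0<..<t}"
  define F where "F = f ` {..<t}"
  have mate_neq': "mate (x (Suc i)) \<noteq> x (Suc i)" if "Suc i < t" for i
    using cov[of "Suc i"] that mate_neq by blast
  have mate_Suc: "mate (x i) \<noteq> x (Suc j)" if "i < t" "j < t" for i j
    using that mate[of i "Suc j"] mate_neq'[of j] by (cases "i = Suc j") auto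
  have f_disj: "f i \<inter> f j = {}" if ij: "i < t" "j < t" "i \<noteq> j" for i j
  proof -
    have "mate (x i) \<noteq> mate (x j)" using inj[of i j] ij by (metis less_imp_le mate_mate)
    then show ?thesis
      using inj[of "Suc i" "Suc j"] mate_Suc[OF ij(1,2)] mate_Suc[OF ij(2,1)] ij
      by (auto simp: f_def)
  qed
  have DM: "D \<subseteq> M" unfolding D_def g_def using cov mate_edge by auto
  have cover: "v \<notin> \<Union>(M - D)" if "v \<in> f i" "i < t" for v i
  proof
    assume "v \<in> \<Union>(M - D)"
    then obtain e where e: "e \<in> M" "e \<notin> D" "v \<in> e" by blast
    have "\<exists>k\<le>t. v = x k \<or> v = mate (x k)"
      using that unfolding f_def by (metis Suc_leI insertE less_imp_le singletonD)
    then obtain k where k: "k \<le> t" "v \<in> g k" by (auto simp: g_def)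
    have "v \<in> \<Union>M" using e by blast
    then have xk: "x k \<in> \<Union>M" using k(2) mate_covered_iff[of "x k"] by (metis g_def insertE singletonD)
    then have "k \<noteq> 0" "k \<noteq> t" using ends by metis+
    then have "0 < k" "k < t" "g k \<in> M" using k mate_edge[OF xk] by (auto simp: g_def)
    then show False using M_disjoint[OF e(1) _ e(3) k(2)] e(2) by (auto simp: D_def)
  qed
  have FE: "F \<subseteq> E" unfolding F_def f_def using edges by auto
  have "matching E ((M - D) \<union> F)"
    unfolding matching_def
  proof (intro conjI ballI impI)
    fix d e assume de: "d \<in> (M - D) \<union> F" "e \<in> (M - D) \<union> F" "d \<noteq> e"
    have MF: "d \<inter> e = {}" if "d \<in> M - D" "e \<in> F" for d e
      using that cover unfolding F_def by blast
    have FF: "d \<inter> e = {}" if "d \<in> F" "e \<in> F" "d \<noteq> e" for d e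
      using that f_disj unfolding F_def by blast
    show "d \<inter> e = {}"
    proof (cases "d \<in> F"; cases "e \<in> F")
      assume "d \<notin> F" "e \<notin> F"
      then show ?thesis using de M_disjoint[of d e] by blast
    qed (use de MF[of d e] MF[of e d] FF[of d e] in auto)
  qed (use FE M_subset in auto)
  moreover have "sum w ((M - D) \<union> F) = sum w M + gain x 0 t"
  proof -
    have disj: "(M - D) \<inter> F = {}"
      using cover unfolding F_def f_def by blast
    have "inj_on f {..<t}" 
      unfolding inj_on_def using f_disj by (metis f_def insert_not_empty lessThan_iff inf.idem)
    then have "sum w F = (\<Sum>i<t. w (f i))" unfolding F_def by (simp add: sum.reindex)
    moreover have "inj_on g {0<..<t}"
    proof (rule inj_onI)
      fix i j assume ij: "i \<in> {0<..<t}" "j \<in> {0<..<t}" "g i = g j"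
      then have "x i = x j \<or> mate (x j) = x i" by (auto simp: g_def)
      then show "i = j" using ij inj[of i j] mate[of j i] by auto
    qed
    then have "sum w D = (\<Sum>i\<in>{0<..<t}. w (g i))" unfolding D_def by (simp add: sum.reindex)
    then have "sum w D = (\<Sum>i\<in>{0<..<t}. mweight (x i))"
      using cov by (simp add: mweight_def g_def)
    then have "sum w D = (\<Sum>i<t. mweight (x i))"
      using mweight_exposed[OF ends(1)]
      by (subst sum.mono_neutral_right[of "{..<t}" "{0<..<t}"]) auto
    moreover have "gain x 0 t = (\<Sum>i<t. w (f i)) - (\<Sum>i<t. mweight (x i))"
      by (simp add: gain_def f_def sum_subtractf atLeast0LessThan)
    moreover have "sum w (M - D) = sum w M - sum w D"
      using DM finite_M by (simp add: sum_diff)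
    moreover have "finite F" using FE finite_E finite_subset by blast
    ultimately show ?thesis
      using sum.union_disjoint[OF _ _ disj, of w] finite_M by simp
  qed
  ultimately show ?thesis
    using assms(2) unfolding max_weight_matching_def by (metis add_le_same_cancel1 not_le)
qed

lemma good_pair_if_max_weight:
  assumes "max_weight_matching E w M" "a \<notin> \<Union>M" "b \<notin> \<Union>M" "good {a}" "good {b}"
  shows "good {a, b}"
proof (rule ccontr)
  let ?A = "\<Union>M \<union> {a, b}"
  assume "\<not> good {a, b}"
  then obtain x t where x: "walk ?A x 0 t" and viol: "mweight (x t) < gain x 0 t"
    and least: "\<And>y s. walk ?A y 0 s \<Longrightarrow> mweight (y s) < gain y 0 s \<Longrightarrow> t \<le> s"
    and cov: "\<And>i. 0 < i \<Longrightarrow> i < t \<Longrightarrow> x i \<in> \<Union>M"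
    by (rule shortest_violating_walk) blast
  have no: "\<not> {x 0, x t} \<subseteq> \<Union>M \<union> {c}" if "c = a \<or> c = b" for c
  proof
    assume c: "{x 0, x t} \<subseteq> \<Union>M \<union> {c}"
    have "x i \<in> \<Union>M \<union> {c}" if "i \<le> t" for i
      using that c cov[of i] by (cases "i = 0 \<or> i = t") auto
    then have "walk (\<Union>M \<union> {c}) x 0 t" using x by (simp add: walk_def)
    moreover have "good {c}" using that assms by blast
    ultimately show False using good_walk viol by fastforce
  qed
  have "x 0 \<in> ?A" "x t \<in> ?A" using x by (auto simp: walk_def)
  then have ends: "{x 0, x t} = {a, b}" "x 0 \<noteq> x t"
    using no[of a] no[of b] by auto
  have ex: "x 0 \<notin> \<Union>M" "x t \<notin> \<Union>M" "good {x 0}" "good {x t}"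
    using ends(1) assms by (auto simp: doubleton_eq_iff)
  have pos: "0 < gain x 0 t" using viol mweight_exposed[OF ex(2)] by simp
  have x': "walk (\<Union>M \<union> {x 0, x t}) x 0 t" using x ends(1) by simp
  note flower = no_flower[OF x' pos ex cov]
  have neq: "x i \<noteq> x j" if ij: "i < j" "j \<le> t" for i j
  proof
    assume eq: "x i = x j"
    have "i \<noteq> 0"
    proof
      assume "i = 0"
      then show False using eq ij ex(1) ends(2) cov[of j] by (cases "j = t") auto
    qed
    moreover have "j \<noteq> t" using eq ij ex(2) cov[of i] calculation by auto
    ultimately have inner: "0 < i" "j < t" using ij by auto
    have "walk (\<Union>M) x i j" using x cov ij inner by (auto simp: walk_def)
    moreover obtain p where "dual (\<Union>M) p" using good_mono[OF ex(3), of "{}"] by (auto simp: good_def)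
    ultimately have "gain x i j \<le> 0" using dual_forward[of "\<Union>M" p x i j] eq ij by simp
    moreover note cut = walk_cut[OF Un_upper1 x ij eq]
    obtain y s where "walk ?A y 0 s" "s < t" "y s = x t" "gain y 0 s = gain x 0 t - gain x i j"
      by (rule that[OF cut(1) _ cut(3) cut(4)]) (use ij in simp)
    ultimately show False using least[of y s] viol by simp
  qed
  then have inj: "x i \<noteq> x j" if "i \<le> t" "j \<le> t" "i \<noteq> j" for i j
    using that by (metis nat_neq_iff)
  have mates: "mate (x i) \<noteq> x j" if ij: "i \<le> t" "j \<le> t" "i \<noteq> j" for i j
  proof (cases "x i \<in> \<Union>M \<and> x j \<in> \<Union>M")
    have sym: "x i = mate (x j)" if "mate (x i) = x j" using that by (metis mate_mate)
    case True
    then have "i \<noteq> 0" "i \<noteq> t" "j \<noteq> 0" "j \<noteq> t" using ex by metis+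
    then have "0 < i" "i < t" "0 < j" "j < t" using ij by auto
    then show ?thesis using flower[of i j] flower[of j i] ij(3) sym
      by (cases "i < j") auto
  next
    case False
    then have "mate (x i) = x i \<or> mate (x j) = x j"
      using mate_exposed[of "x i"] mate_exposed[of "x j"] by argo
    then show ?thesis using inj[OF ij] by (metis mate_mate)
  qed
  have "\<not> max_weight_matching E w M"
  proof (rule augmenting_path[of t x])
    show "{mate (x i), x (Suc i)} \<in> E" if "i < t" for i
      using x that by (simp add: walk_def)
  qed (fact pos ex cov inj mates)+
  then show False using assms(1) by contradiction
qed

subsection \<open>The Bellman-Ford algorithm\<close>

definition relax :: "'a set \<Rightarrow> 'a \<Rightarrow> 'a \<Rightarrow> ('a \<Rightarrow> real) \<Rightarrow> 'a \<Rightarrow> real" where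
  "relax A a b L = (if a \<in> A \<and> b \<in> A \<and> L a < L (mate b) + w {a, b} - mweight b
     then L(a := L (mate b) + w {a, b} - mweight b) else L)"

text \<open>Invariant of the Bellman-Ford algorithm after \<open>r\<close> rounds, when the edges in
  directions \<open>D\<close> have been relaxed in the current round.\<close>

definition bf :: "'a set \<Rightarrow> nat \<Rightarrow> ('a \<times> 'a) set \<Rightarrow> ('a \<Rightarrow> real) \<Rightarrow> bool" where
  "bf A r D L \<longleftrightarrow>
     (\<forall>v\<in>A. \<exists>x t. walk A x 0 t \<and> x t = v \<and> gain x 0 t = L v) \<and>
     (\<forall>x t. walk A x 0 t \<longrightarrow> t \<le> r \<longrightarrow> gain x 0 t \<le> L (x t)) \<and>
     (\<forall>x. walk A x 0 (Suc r) \<longrightarrow> (x (Suc r), mate (x r)) \<in> D \<longrightarrow> gain x 0 (Suc r) \<le> L (x (Suc r)))"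

lemma bf_init: assumes "\<And>v. v \<in> A \<Longrightarrow> L v = 0" shows "bf A 0 {} L"
  unfolding bf_def
proof (intro conjI ballI allI impI)
  fix v assume "v \<in> A"
  then show "\<exists>x t. walk A x 0 t \<and> x t = v \<and> gain x 0 t = L v"
    using assms by (intro exI[of _ "\<lambda>_. v"] exI[of _ 0]) (auto simp: walk_def)
qed (auto simp: assms walk_def)

lemma bf_round: "bf A r D L \<Longrightarrow> (\<And>a b. {a, b} \<in> E \<Longrightarrow> (a, b) \<in> D) \<Longrightarrow> bf A (Suc r) {} L"
  unfolding bf_def by (auto simp: le_Suc_eq walk_def insert_commute)

context
  fixes A assumes cov: "\<Union>M \<subseteq> A"
begin

lemma bf_relax:
  assumes bf: "bf A r D L" and ab: "{a, b} \<in> E"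
  shows "bf A r (insert (a, b) D) (relax A a b L)"
proof -
  let ?L = "relax A a b L"
  have le: "L v \<le> ?L v" for v by (simp add: relax_def)
  have up: "L (mate b) + w {a, b} - mweight b \<le> ?L a" if "a \<in> A" "b \<in> A"
    using that by (simp add: relax_def)
  note bf' = bf[unfolded bf_def]
  show ?thesis
    unfolding bf_def
  proof (intro conjI ballI allI impI)
    fix v assume v: "v \<in> A"
    show "\<exists>x t. walk A x 0 t \<and> x t = v \<and> gain x 0 t = ?L v"
    proof (cases "?L v = L v")
      case True
      then show ?thesis using bf' v by simp
    next
      case False
      then have f: "v = a" "a \<in> A" "b \<in> A" "?L v = L (mate b) + w {a, b} - mweight b"
        by (auto simp: relax_def split: if_splits)
      then obtain x t where x: "walk A x 0 t" "x t = mate b" "gain x 0 t = L (mate b)"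
        using bf' mate_closed[OF cov f(3)] by blast
      then have m: "mate (x t) = b" by simp
      show ?thesis
        using walk_extend[OF cov x(1), of a] f x(2,3) ab unfolding m
        by (intro exI[of _ "x(Suc t := a)"] exI[of _ "Suc t"]) simp
    qed
  next
    fix x t assume "walk A x 0 t" "t \<le> r"
    then show "gain x 0 t \<le> ?L (x t)" using bf' le order_trans by blast
  next
    fix x assume x: "walk A x 0 (Suc r)" "(x (Suc r), mate (x r)) \<in> insert (a, b) D"
    show "gain x 0 (Suc r) \<le> ?L (x (Suc r))"
    proof (cases "(x (Suc r), mate (x r)) \<in> D")
      case True
      then show ?thesis using bf' x le order_trans by blast
    next
      case False
      then have e: "x (Suc r) = a" "mate (x r) = b" using x(2) by auto
      then have xr: "x r = mate b" by auto
      have "x r \<in> A" "a \<in> A" using x(1) e by (auto simp: walk_def)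
      then have "b \<in> A" using e mate_closed[OF cov] by blast
      moreover have "gain x 0 r \<le> L (mate b)" using bf' walk_sub[OF x(1), of 0 r] xr by fastforce
      ultimately show ?thesis
        using up \<open>a \<in> A\<close> e xr by (simp add: gain_Suc insert_commute)
    qed
  qed
qed

lemma bf_final:
  assumes "A \<subseteq> V" and bf: "bf A (card V) {} L"
  shows "(\<exists>p. dual A p) \<longleftrightarrow> dual A L"
proof
  assume "\<exists>p. dual A p"
  then obtain p where p: "dual A p" by blast
  note bf' = bf[unfolded bf_def]
  have max: "gain x 0 t \<le> L (x t)" if "walk A x 0 t" for x t
    using walk_shorten[OF cov p assms(1) that] bf' by force
  show "dual A L"
    unfolding dual_def
  proof (intro conjI ballI impI)
    fix v assume v: "v \<in> A"
    show "0 \<le> L v" using max[of "\<lambda>_. v" 0] v by (simp add: walk_def)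
    obtain x t where x: "walk A x 0 t" "x t = v" "gain x 0 t = L v" using bf' v by blast
    then have "L v \<le> p v" using walk_gain_le[OF cov p] by force
    also have "\<dots> \<le> mweight v" using p v by (simp add: dual_def)
    finally show "L v \<le> mweight v" .
  next
    fix u v assume uv: "u \<in> A" "v \<in> A" "{u, v} \<in> E"
    obtain x t where x: "walk A x 0 t" "x t = mate v" "gain x 0 t = L (mate v)"
      using bf' mate_closed[OF cov uv(2)] by blast
    then have m: "mate (x t) = v" by simp
    show "L (mate v) + w {u, v} - mweight v \<le> L u"
      using max[OF walk_extend(1)[OF cov x(1), of u]] walk_extend(2)[OF cov x(1), of u] uv x(2,3)
      unfolding m by simp
  qed
qed blast

end

subsection \<open>Greedy covering of the conflicts\<close>

lemma vertex_stabilizer_iff_good: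
  "vertex_stabilizer V E w M T \<longleftrightarrow> T \<subseteq> V - \<Union>M \<and> good (V - \<Union>M - T)"
proof (cases "T \<subseteq> V \<and> T \<inter> \<Union>M = {}")
  case True
  then have "V - T = \<Union>M \<union> (V - \<Union>M - T)" using covered_subset by blast
  then show ?thesis using True unfolding vertex_stabilizer_iff good_def by auto
next
  case False
  then show ?thesis unfolding vertex_stabilizer_iff by blast
qed

lemma stabilizer_exists_iff: "(\<exists>T. vertex_stabilizer V E w M T) \<longleftrightarrow> good {}"
proof
  assume "\<exists>T. vertex_stabilizer V E w M T"
  then show "good {}" unfolding vertex_stabilizer_iff_good using good_mono by blast
next
  assume "good {}"
  then show "\<exists>T. vertex_stabilizer V E w M T"
    unfolding vertex_stabilizer_iff_good by (intro exI[of _ "V - \<Union>M"]) simp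
qed

definition cover_step :: "'a \<Rightarrow> 'a \<Rightarrow> 'a set \<Rightarrow> 'a set" where
  "cover_step a b S = (if a \<in> V - \<Union>M - S \<and> b \<in> V - \<Union>M - S \<and> \<not> good {a, b}
     then insert a (insert b S) else S)"

definition covering :: "('a \<times> 'a) set \<Rightarrow> 'a set \<Rightarrow> bool" where
  "covering P S \<longleftrightarrow> S \<subseteq> V - \<Union>M \<and>
     (\<forall>(a, b)\<in>P. a \<in> V - \<Union>M - S \<longrightarrow> b \<in> V - \<Union>M - S \<longrightarrow> good {a, b}) \<and>
     (\<forall>T. vertex_stabilizer V E w M T \<longrightarrow>
        card S \<le> 2 * card (S \<inter> T) \<and> (max_weight_matching E w M \<longrightarrow> S \<subseteq> T))"

lemma covering_init: "covering {} {}"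
  by (simp add: covering_def)

lemma covering_step:
  assumes S: "covering P S" and "a \<noteq> b \<Longrightarrow> (a, a) \<in> P \<and> (b, b) \<in> P"
  shows "covering (insert (a, b) P) (cover_step a b S)"
proof (cases "a \<in> V - \<Union>M - S \<and> b \<in> V - \<Union>M - S \<and> \<not> good {a, b}")
  case True
  let ?S = "insert a (insert b S)"
  have finS: "finite S" using S finite_V finite_subset by (auto simp: covering_def)
  have "card ?S \<le> 2 * card (?S \<inter> T) \<and> (max_weight_matching E w M \<longrightarrow> ?S \<subseteq> T)"
    if T: "vertex_stabilizer V E w M T" for T
  proof -
    have hit: "a \<in> T \<or> b \<in> T"
    proof (rule ccontr)
      assume "\<not> (a \<in> T \<or> b \<in> T)"
      then have "{a, b} \<subseteq> V - \<Union>M - T" using True by blast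
      then show False using True T good_mono unfolding vertex_stabilizer_iff_good by metis
    qed
    have IH: "card S \<le> 2 * card (S \<inter> T)" "max_weight_matching E w M \<longrightarrow> S \<subseteq> T"
      using S T by (auto simp: covering_def)
    show ?thesis
    proof (cases "a = b")
      case eq: True
      then show ?thesis using IH hit True finS by auto
    next
      case neq: False
      have "Suc (card (S \<inter> T)) = card (insert (if a \<in> T then a else b) (S \<inter> T))"
        using finS True by simp
      also have "\<dots> \<le> card (?S \<inter> T)" by (rule card_mono) (use finS hit in auto)
      finally have "card ?S \<le> 2 * card (?S \<inter> T)" using IH(1) finS True neq by simp
      moreover have "\<not> max_weight_matching E w M"
      proof
        assume mx: "max_weight_matching E w M"
        have "(a, a) \<in> P" "(b, b) \<in> P" using assms(2)[OF neq] by auto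
        then have "good {a, a}" "good {b, b}" using S True unfolding covering_def by blast+
        then show False using good_pair_if_max_weight[OF mx, of a b] True by auto
      qed
      ultimately show ?thesis by blast
    qed
  qed
  then show ?thesis using True S by (auto simp: covering_def cover_step_def)
next
  case False
  then show ?thesis using S by (auto simp: covering_def cover_step_def)
qed

lemma covering_final:
  assumes "covering P S" "good {}" "\<And>a b. a \<in> V \<Longrightarrow> b \<in> V \<Longrightarrow> (a, b) \<in> P \<or> (b, a) \<in> P"
  shows "approx_stabilizer 2 V E w M S"
    and "max_weight_matching E w M \<Longrightarrow> min_stabilizer V E w M S"
proof -
  have "good (V - \<Union>M - S)"
  proof (rule good_if_pairs_good[OF assms(2)])
    fix a b assume ab: "a \<in> V - \<Union>M - S" "b \<in> V - \<Union>M - S"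
    then show "good {a, b}"
      using assms(1) assms(3)[of a b] unfolding covering_def by (fastforce simp: insert_commute)
  qed
  then have S: "vertex_stabilizer V E w M S"
    using assms(1) by (simp add: vertex_stabilizer_iff_good covering_def)
  have fin: "finite T" if "vertex_stabilizer V E w M T" for T
    using that finite_V finite_subset by (auto simp: vertex_stabilizer_def)
  have "card S \<le> 2 * card T" if T: "vertex_stabilizer V E w M T" for T
    using assms(1) T card_mono[OF fin[OF T], of "S \<inter> T"] by (force simp: covering_def)
  then show "approx_stabilizer 2 V E w M S" using S by (simp add: approx_stabilizer_def)
  show "min_stabilizer V E w M S" if "max_weight_matching E w M"
    unfolding min_stabilizer_def
  proof (intro conjI allI impI S)
    fix T assume T: "vertex_stabilizer V E w M T"
    then have "S \<subseteq> T" using assms(1) that by (simp add: covering_def)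
    then show "card S \<le> card T" by (rule card_mono[OF fin[OF T]])
  qed
qed

end

section \<open>Program verification\<close>

definition runs :: "com \<Rightarrow> state \<Rightarrow> nat \<Rightarrow> (state \<Rightarrow> bool) \<Rightarrow> bool" where
  "runs c s T Q \<longleftrightarrow> (\<exists>t s'. exec c s t s' \<and> t \<le> T \<and> Q s')"

lemma runs_mono: "runs c s T Q \<Longrightarrow> T \<le> T' \<Longrightarrow> (\<And>s'. Q s' \<Longrightarrow> Q' s') \<Longrightarrow> runs c s T' Q'"
  unfolding runs_def using order_trans by blast

lemma runs_Skip: "Q s \<Longrightarrow> 1 \<le> T \<Longrightarrow> runs Skip s T Q"
  unfolding runs_def using exec.Skip by blast

lemma runs_NAssign: "Q (s\<lparr>nvar := (nvar s)(x := nval a s)\<rparr>) \<Longrightarrow> 1 \<le> T \<Longrightarrow> runs (NAssign x a) s T Q"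
  unfolding runs_def using exec.NAssign by blast

lemma runs_NStore:
  "Q (s\<lparr>narr := (narr s)(a := (narr s a)(nval i s := nval b s))\<rparr>) \<Longrightarrow> 1 \<le> T \<Longrightarrow> runs (NStore a i b) s T Q"
  unfolding runs_def using exec.NStore by blast

lemma runs_RStore:
  "Q (s\<lparr>rarr := (rarr s)(a := (rarr s a)(nval i s := rval b s))\<rparr>) \<Longrightarrow> 1 \<le> T \<Longrightarrow> runs (RStore a i b) s T Q"
  unfolding runs_def using exec.RStore by blast

lemma runs_Seq: "runs c s T (\<lambda>s'. runs d s' U Q) \<Longrightarrow> runs (Seq c d) s (T + U) Q"
  unfolding runs_def using exec.Seq add_mono by meson

lemma runs_Cond:
  "(bval b s \<Longrightarrow> runs c s T Q) \<Longrightarrow> (\<not> bval b s \<Longrightarrow> runs d s T Q) \<Longrightarrow> runs (Cond b c d) s (1 + T) Q"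
  unfolding runs_def using exec.CondTrue exec.CondFalse add_left_mono by meson

definition For :: "name \<Rightarrow> nexp \<Rightarrow> com \<Rightarrow> com" where
  "For x N c = Seq (NAssign x (NConst 0))
     (While (NLess (NVar x) N) (Seq c (NAssign x (NPlus (NVar x) (NConst 1)))))"

lemma runs_For:
  assumes init: "I 0 (s\<lparr>nvar := (nvar s)(x := 0)\<rparr>)"
    and bound: "\<And>i s. I i s \<Longrightarrow> nval b s = N"
    and body: "\<And>i s. i < N \<Longrightarrow> I i s \<Longrightarrow> nvar s x = i \<Longrightarrow>
      runs c s T (\<lambda>s'. nvar s' x = i \<and> I (Suc i) (s'\<lparr>nvar := (nvar s')(x := Suc i)\<rparr>))"
    and exit: "\<And>s. I N s \<Longrightarrow> Q s"
    and N: "N \<le> B"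
  shows "runs (For x b c) s (2 + B * (T + 2)) Q"
proof -
  let ?inc = "NAssign x (NPlus (NVar x) (NConst 1))"
  let ?W = "While (NLess (NVar x) b) (Seq c ?inc)"
  have loop: "runs ?W s (1 + (N - i) * (T + 2)) Q" if "I i s" "nvar s x = i" "i \<le> N" for i s
    using that(3,1,2)
  proof (induction i arbitrary: s rule: inc_induct)
    case base
    then have "exec ?W s 1 s" using bound[of N s] by (intro exec.WhileFalse) simp
    then show ?case unfolding runs_def using exit base by fastforce
  next
    case (step i)
    have "bval (NLess (NVar x) b) s" using bound[of i s] step by simp
    moreover obtain t s' where c: "exec c s t s'" "t \<le> T" "nvar s' x = i"
        "I (Suc i) (s'\<lparr>nvar := (nvar s')(x := Suc i)\<rparr>)"
      using body[of i s] step unfolding runs_def by blast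
    moreover have "exec ?inc s' 1 (s'\<lparr>nvar := (nvar s')(x := Suc i)\<rparr>)"
      using exec.NAssign[of x "NPlus (NVar x) (NConst 1)" s'] c(3) by simp
    moreover obtain t' s'' where W: "exec ?W (s'\<lparr>nvar := (nvar s')(x := Suc i)\<rparr>) t' s''"
        "t' \<le> 1 + (N - Suc i) * (T + 2)" "Q s''"
      using step.IH[OF c(4)] unfolding runs_def by auto
    ultimately have "exec ?W s (1 + (t + 1) + t') s''"
      by (blast intro: exec.WhileTrue exec.Seq)
    moreover have "(N - i) * (T + 2) = (T + 2) + (N - Suc i) * (T + 2)"
      using step.hyps by (metis Suc_diff_Suc mult_Suc)
    then have "1 + (t + 1) + t' \<le> 1 + (N - i) * (T + 2)" using c(2) W(2) by linarith
    ultimately show ?case unfolding runs_def using W(3) by blast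
  qed
  have "runs ?W (s\<lparr>nvar := (nvar s)(x := 0)\<rparr>) (1 + (N - 0) * (T + 2)) Q"
    by (rule loop[OF init]) simp_all
  then have "runs (For x b c) s (1 + (1 + (N - 0) * (T + 2))) Q"
    unfolding For_def by (intro runs_Seq runs_NAssign) simp_all
  then show ?thesis by (rule runs_mono) (use mult_le_mono1[OF N, of "T + 2"] in simp_all)
qed

section \<open>The program\<close>

abbreviation (input) "reg_eq a b \<equiv> BAnd (BNot (NLess a b)) (BNot (NLess b a))"

abbreviation (input) "bor a b \<equiv> BNot (BAnd (BNot a) (BNot b))"

definition exposed_exp :: "nexp \<Rightarrow> bexp" where
  "exposed_exp x = reg_eq (NArr ''mate'' x) x"

definition active_exp :: "nexp \<Rightarrow> bexp" where
  "active_exp x = bor (BNot (exposed_exp x)) (bor (reg_eq x (NVar ''a'')) (reg_eq x (NVar ''b'')))"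

definition bound_exp :: "nexp \<Rightarrow> rexp" where
  "bound_exp y = RMinus (RPlus (RArr ''L'' (NArr ''mate'' y)) (RArr ''w'' (NVar ''k''))) (RArr ''c'' y)"

definition violated_exp :: "nexp \<Rightarrow> nexp \<Rightarrow> bexp" where
  "violated_exp x y = BAnd (active_exp x) (BAnd (active_exp y) (RLess (RArr ''L'' x) (bound_exp y)))"

definition relax_com :: "nexp \<Rightarrow> nexp \<Rightarrow> com" where
  "relax_com x y = Cond (violated_exp x y) (RStore ''L'' x (bound_exp y)) Skip"

abbreviation (input) "end1 \<equiv> NArr ''u'' (NVar ''k'')"

abbreviation (input) "end2 \<equiv> NArr ''v'' (NVar ''k'')"

definition bellman_ford_com :: com where
  "bellman_ford_com =
     Seq (For ''k'' (NVar ''n'') (RStore ''L'' (NVar ''k'') RZero))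
       (For ''r'' (NVar ''n'')
         (For ''k'' (NVar ''m'') (Seq (relax_com end1 end2) (relax_com end2 end1))))"

definition reject_if :: "bexp \<Rightarrow> com" where
  "reject_if b = Cond b (NAssign ''ok'' (NConst 0)) Skip"

definition check_com :: com where
  "check_com = Seq (NAssign ''ok'' (NConst 1))
     (Seq (For ''k'' (NVar ''m'') (reject_if (bor (violated_exp end1 end2) (violated_exp end2 end1))))
       (For ''k'' (NVar ''n'') (reject_if (BAnd (active_exp (NVar ''k''))
          (RLess (RArr ''c'' (NVar ''k'')) (RArr ''L'' (NVar ''k'')))))))"

definition test_com :: com where
  "test_com = Seq bellman_ford_com check_com"

definition init_com :: com where
  "init_com = Seq (For ''k'' (NVar ''n'') (NStore ''mate'' (NVar ''k'') (NVar ''k'')))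
     (For ''k'' (NVar ''m'') (Cond (NLess (NConst 0) (NArr ''M'' (NVar ''k'')))
        (Seq (Seq (NStore ''mate'' end1 end2) (NStore ''mate'' end2 end1))
          (Seq (RStore ''c'' end1 (RArr ''w'' (NVar ''k''))) (RStore ''c'' end2 (RArr ''w'' (NVar ''k'')))))
        Skip))"

definition cover_com :: com where
  "cover_com = Cond (BAnd (BAnd (NLess (NVar ''ok'') (NConst 1)) (NLess (NVar ''b'') (NVar ''n'')))
       (BAnd (BAnd (exposed_exp (NVar ''a'')) (exposed_exp (NVar ''b'')))
         (BAnd (NLess (NArr ''S'' (NVar ''a'')) (NConst 1)) (NLess (NArr ''S'' (NVar ''b'')) (NConst 1)))))
     (Seq (NStore ''S'' (NVar ''a'') (NConst 1)) (NStore ''S'' (NVar ''b'') (NConst 1))) Skip"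

text \<open>Pairs are processed in the order of increasing difference, so that the single bad vertices
  are removed first.\<close>

definition stabilizer_com :: com where
  "stabilizer_com = Seq init_com
     (Seq
       (For ''d'' (NVar ''n'') (For ''i'' (NVar ''n'')
         (Seq (Seq (NAssign ''a'' (NVar ''i'')) (NAssign ''b'' (NPlus (NVar ''i'') (NVar ''d''))))
           (Seq test_com cover_com))))
       (Seq (Seq (NAssign ''a'' (NVar ''n'')) (NAssign ''b'' (NVar ''n''))) test_com))"

text \<open>Polymorphic, so that the same expression also denotes the polynomial bound.\<close>

definition test_time :: "'a::comm_semiring_1 \<Rightarrow> 'a" where
  "test_time B = (2 + B * (1 + 2)) + (2 + B * ((2 + B * ((2 + 2) + 2)) + 2))
     + (1 + ((2 + B * (2 + 2)) + (2 + B * (2 + 2))))"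

definition stabilizer_time :: "'a::comm_semiring_1 \<Rightarrow> 'a" where
  "stabilizer_time B = ((2 + B * (1 + 2)) + (2 + B * ((1 + ((1 + 1) + (1 + 1))) + 2)))
     + ((2 + B * ((2 + B * (((1 + 1) + (test_time B + (1 + (1 + 1)))) + 2)) + 2)) + ((1 + 1) + test_time B))"

lemma poly_test_time: "poly (test_time [:0, 1:]) B = test_time B"
  by (simp add: test_time_def)

lemma poly_stabilizer_time: "poly (stabilizer_time [:0, 1:]) B = stabilizer_time B"
  by (simp add: stabilizer_time_def poly_test_time)

section \<open>Correctness of the program\<close>

locale encoded_matching = weighted_matching "{..<n}" E w M
  for n :: nat and E w M +
  fixes u v :: "nat \<Rightarrow> nat" and m B :: nat
  assumes E_eq: "E = (\<lambda>k. {u k, v k}) ` {..<m}"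
    and size: "n \<le> B" "m \<le> B"
begin

definition input :: "state \<Rightarrow> bool" where
  "input s \<longleftrightarrow> nvar s ''n'' = n \<and> nvar s ''m'' = m \<and>
     (\<forall>k<m. narr s ''u'' k = u k \<and> narr s ''v'' k = v k \<and> rarr s ''w'' k = w {u k, v k} \<and>
        narr s ''M'' k = (if {u k, v k} \<in> M then 1 else 0))"

definition ready :: "state \<Rightarrow> bool" where
  "ready s \<longleftrightarrow> input s \<and> (\<forall>x<n. narr s ''mate'' x = mate x \<and> rarr s ''c'' x = mweight x)"

definition same :: "state \<Rightarrow> state \<Rightarrow> bool" where
  "same s s' \<longleftrightarrow> narr s' = narr s \<and> (\<forall>a. a \<noteq> ''L'' \<longrightarrow> rarr s' a = rarr s a) \<and>
     (\<forall>x. x \<notin> {''k'', ''r'', ''ok''} \<longrightarrow> nvar s' x = nvar s x)"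

definition active :: "state \<Rightarrow> nat set" where
  "active s = \<Union>M \<union> ({nvar s ''a'', nvar s ''b''} \<inter> {..<n})"

lemma edge_bounds: "k < m \<Longrightarrow> u k < n \<and> v k < n \<and> {u k, v k} \<in> E"
  using edge_subset[of "{u k, v k}"] E_eq by auto

lemma same_ready: "same s s' \<Longrightarrow> ready s \<Longrightarrow> ready s'"
  by (simp add: same_def ready_def input_def)

lemma same_active: "same s s' \<Longrightarrow> active s' = active s"
  by (simp add: same_def active_def)

lemma bval_exposed: "ready s \<Longrightarrow> nval x s < n \<Longrightarrow> bval (exposed_exp x) s \<longleftrightarrow> nval x s \<notin> \<Union>M"
  unfolding mate_eq_self_iff[symmetric] by (auto simp: exposed_exp_def ready_def)

lemma bval_active: "ready s \<Longrightarrow> nval x s < n \<Longrightarrow> bval (active_exp x) s \<longleftrightarrow> nval x s \<in> active s"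
  using bval_exposed[of s x] by (auto simp: active_exp_def active_def)

lemma rval_bound:
  "ready s \<Longrightarrow> nval y s < n \<Longrightarrow>
    rval (bound_exp y) s = rarr s ''L'' (mate (nval y s)) + rarr s ''w'' (nvar s ''k'') - mweight (nval y s)"
  by (simp add: bound_exp_def ready_def)

lemma bval_violated:
  assumes "ready s" "nval x s = a" "nval y s = b" "a < n" "b < n" "rarr s ''w'' (nvar s ''k'') = w {a, b}"
  shows "bval (violated_exp x y) s \<longleftrightarrow> a \<in> active s \<and> b \<in> active s \<and>
    rarr s ''L'' a < rarr s ''L'' (mate b) + w {a, b} - mweight b"
  using assms bval_active[of s x] bval_active[of s y] rval_bound[of s y]
  by (auto simp: violated_exp_def)

lemma runs_relax:
  assumes "ready s" "nval x s = a" "nval y s = b" "a < n" "b < n" "rarr s ''w'' (nvar s ''k'') = w {a, b}"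
    and "Q (s\<lparr>rarr := (rarr s)(''L'' := relax (active s) a b (rarr s ''L''))\<rparr>)"
  shows "runs (relax_com x y) s 2 Q"
proof -
  have "runs (relax_com x y) s (1 + 1) Q"
    unfolding relax_com_def
    by (intro runs_Cond runs_RStore runs_Skip)
      (use assms bval_violated[OF assms(1-6)] rval_bound[of s y] in \<open>auto simp: relax_def\<close>)
  then show ?thesis by (simp add: numeral_2_eq_2)
qed

lemma runs_reject_loop:
  assumes s: "ready s" and "nval b s = N" "b = NVar ''n'' \<or> b = NVar ''m''"
    and P: "\<And>s'. same s s' \<Longrightarrow> rarr s' ''L'' = rarr s ''L'' \<Longrightarrow> nvar s' ''k'' < N \<Longrightarrow>
       bval c s' \<longleftrightarrow> \<not> P (nvar s' ''k'')"
    and Q: "\<And>s'. same s s' \<Longrightarrow> rarr s' ''L'' = rarr s ''L'' \<Longrightarrow>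
       nvar s' ''ok'' = (if \<forall>k<N. P k then nvar s ''ok'' else 0) \<Longrightarrow> Q s'"
  shows "runs (For ''k'' b (reject_if c)) s (2 + B * (2 + 2)) Q"
proof (rule runs_For[where N = N and I = "\<lambda>i s'. same s s' \<and> rarr s' ''L'' = rarr s ''L'' \<and>
       nvar s' ''ok'' = (if \<forall>k<i. P k then nvar s ''ok'' else 0)"])
  fix i s' assume i: "i < N" and I: "same s s' \<and> rarr s' ''L'' = rarr s ''L'' \<and>
       nvar s' ''ok'' = (if \<forall>k<i. P k then nvar s ''ok'' else 0)" "nvar s' ''k'' = i"
  have "runs (reject_if c) s' (1 + 1) (\<lambda>s''. nvar s'' ''k'' = i \<and> same s (s''\<lparr>nvar := (nvar s'')(''k'' := Suc i)\<rparr>) \<and>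
    rarr (s''\<lparr>nvar := (nvar s'')(''k'' := Suc i)\<rparr>) ''L'' = rarr s ''L'' \<and>
    nvar (s''\<lparr>nvar := (nvar s'')(''k'' := Suc i)\<rparr>) ''ok'' = (if \<forall>k<Suc i. P k then nvar s ''ok'' else 0))"
    unfolding reject_if_def
    by (intro runs_Cond runs_NAssign runs_Skip)
      (use I i P[of s'] in \<open>auto simp: same_def less_Suc_eq\<close>)
  then show "runs (reject_if c) s' 2 (\<lambda>s''. nvar s'' ''k'' = i \<and> same s (s''\<lparr>nvar := (nvar s'')(''k'' := Suc i)\<rparr>) \<and>
    rarr (s''\<lparr>nvar := (nvar s'')(''k'' := Suc i)\<rparr>) ''L'' = rarr s ''L'' \<and>
    nvar (s''\<lparr>nvar := (nvar s'')(''k'' := Suc i)\<rparr>) ''ok'' = (if \<forall>k<Suc i. P k then nvar s ''ok'' else 0))"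
    by (simp add: numeral_2_eq_2)
qed (use assms size in \<open>auto simp: same_def ready_def input_def\<close>)

lemma runs_bellman_ford:
  assumes s: "ready s"
    and Q: "\<And>s'. same s s' \<Longrightarrow> bf (active s) n {} (rarr s' ''L'') \<Longrightarrow> Q s'"
  shows "runs bellman_ford_com s ((2 + B * (1 + 2)) + (2 + B * ((2 + B * ((2 + 2) + 2)) + 2))) Q"
  unfolding bellman_ford_com_def
proof (rule runs_Seq, rule runs_For[where N = n and I = "\<lambda>i s'. same s s' \<and> (\<forall>k<i. rarr s' ''L'' k = 0)"])
  let ?A = "active s"
  have cov: "\<Union>M \<subseteq> ?A" and AV: "?A \<subseteq> {..<n}"
    using covered_subset by (auto simp: active_def)
  let ?D = "\<lambda>k. {(a, b). \<exists>j<k. {a, b} = {u j, v j}}"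
  have D_Suc: "?D (Suc k) = insert (v k, u k) (insert (u k, v k) (?D k))" for k
    by (auto simp: less_Suc_eq doubleton_eq_iff)
  fix s1 assume s1: "same s s1 \<and> (\<forall>k<n. rarr s1 ''L'' k = 0)"
  then have bf0: "bf ?A 0 {} (rarr s1 ''L'')" using AV by (intro bf_init) auto
  show "runs (For ''r'' (NVar ''n'')
         (For ''k'' (NVar ''m'') (Seq (relax_com end1 end2) (relax_com end2 end1)))) s1
         (2 + B * ((2 + B * ((2 + 2) + 2)) + 2)) Q"
  proof (rule runs_For[where N = n and I = "\<lambda>i s'. same s s' \<and> bf ?A i {} (rarr s' ''L'')"])
    fix r s2 assume s2: "same s s2 \<and> bf ?A r {} (rarr s2 ''L'')" "nvar s2 ''r'' = r" "r < n"
    show "runs (For ''k'' (NVar ''m'') (Seq (relax_com end1 end2) (relax_com end2 end1))) s2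
         (2 + B * ((2 + 2) + 2)) (\<lambda>s'. nvar s' ''r'' = r \<and> same s (s'\<lparr>nvar := (nvar s')(''r'' := Suc r)\<rparr>) \<and>
           bf ?A (Suc r) {} (rarr (s'\<lparr>nvar := (nvar s')(''r'' := Suc r)\<rparr>) ''L''))"
    proof (rule runs_For[where N = m and I = "\<lambda>i s'. same s s' \<and> nvar s' ''r'' = r \<and> bf ?A r (?D i) (rarr s' ''L'')"])
      fix k s3 assume s3: "same s s3 \<and> nvar s3 ''r'' = r \<and> bf ?A r (?D k) (rarr s3 ''L'')"
        "nvar s3 ''k'' = k" "k < m"
      have rdy: "ready s3" using s same_ready s3 by blast
      then have inp: "narr s3 ''u'' k = u k" "narr s3 ''v'' k = v k" "rarr s3 ''w'' k = w {u k, v k}"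
        using s3 by (auto simp: ready_def input_def)
      let ?L1 = "relax ?A (u k) (v k) (rarr s3 ''L'')"
      let ?s = "s3\<lparr>rarr := (rarr s3)(''L'' := ?L1)\<rparr>"
      have same: "same s ?s" using s3 by (simp add: same_def)
      have act: "active s3 = ?A" "active ?s = ?A" using same_active same s3 by blast+
      have bf2: "bf ?A r (?D (Suc k)) (relax ?A (v k) (u k) ?L1)"
        unfolding D_Suc using s3 edge_bounds[of k]
        by (intro bf_relax cov) (auto simp: insert_commute)
      show "runs (Seq (relax_com end1 end2) (relax_com end2 end1)) s3 (2 + 2)
        (\<lambda>s'. nvar s' ''k'' = k \<and> same s (s'\<lparr>nvar := (nvar s')(''k'' := Suc k)\<rparr>) \<and>
          nvar (s'\<lparr>nvar := (nvar s')(''k'' := Suc k)\<rparr>) ''r'' = r \<and>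
          bf ?A r (?D (Suc k)) (rarr (s'\<lparr>nvar := (nvar s')(''k'' := Suc k)\<rparr>) ''L''))"
      proof (rule runs_Seq, rule runs_relax[OF rdy, where a = "u k" and b = "v k"])
        show "runs (relax_com end2 end1) (s3\<lparr>rarr := (rarr s3)(''L'' := relax (active s3) (u k) (v k) (rarr s3 ''L''))\<rparr>) 2
        (\<lambda>s'. nvar s' ''k'' = k \<and> same s (s'\<lparr>nvar := (nvar s')(''k'' := Suc k)\<rparr>) \<and>
          nvar (s'\<lparr>nvar := (nvar s')(''k'' := Suc k)\<rparr>) ''r'' = r \<and>
          bf ?A r (?D (Suc k)) (rarr (s'\<lparr>nvar := (nvar s')(''k'' := Suc k)\<rparr>) ''L''))"
          unfolding act
        proof (rule runs_relax[OF same_ready[OF same s], where a = "v k" and b = "u k"])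
          let ?t = "?s\<lparr>rarr := (rarr ?s)(''L'' := relax (active ?s) (v k) (u k) (rarr ?s ''L''))\<rparr>"
          show "nvar ?t ''k'' = k \<and> same s (?t\<lparr>nvar := (nvar ?t)(''k'' := Suc k)\<rparr>) \<and>
            nvar (?t\<lparr>nvar := (nvar ?t)(''k'' := Suc k)\<rparr>) ''r'' = r \<and>
            bf ?A r (?D (Suc k)) (rarr (?t\<lparr>nvar := (nvar ?t)(''k'' := Suc k)\<rparr>) ''L'')"
            unfolding act using s3 bf2 by (simp add: same_def)
        qed (use inp s3 edge_bounds in \<open>simp_all add: insert_commute\<close>)
      qed (use inp s3 edge_bounds in simp_all)
    next
      fix s3 assume s3: "same s s3 \<and> nvar s3 ''r'' = r \<and> bf ?A r (?D m) (rarr s3 ''L'')"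
      then have "bf ?A (Suc r) {} (rarr s3 ''L'')"
        by (elim conjE bf_round) (use E_eq in auto)
      then show "nvar s3 ''r'' = r \<and> same s (s3\<lparr>nvar := (nvar s3)(''r'' := Suc r)\<rparr>) \<and>
           bf ?A (Suc r) {} (rarr (s3\<lparr>nvar := (nvar s3)(''r'' := Suc r)\<rparr>) ''L'')"
        using s3 by (simp add: same_def)
    qed (use s s2 size in \<open>auto simp: same_def ready_def input_def\<close>)
  qed (use s s1 bf0 Q size in \<open>simp_all add: same_def ready_def input_def\<close>)
next
  fix i s' assume I: "same s s' \<and> (\<forall>k<i. rarr s' ''L'' k = 0)" "nvar s' ''k'' = i"
  show "runs (RStore ''L'' (NVar ''k'') RZero) s' 1
    (\<lambda>s'. nvar s' ''k'' = i \<and> same s (s'\<lparr>nvar := (nvar s')(''k'' := Suc i)\<rparr>) \<and>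
      (\<forall>k<Suc i. rarr (s'\<lparr>nvar := (nvar s')(''k'' := Suc i)\<rparr>) ''L'' k = 0))"
    by (rule runs_RStore) (use I in \<open>auto simp: same_def less_Suc_eq\<close>)
qed (use s size in \<open>auto simp: same_def ready_def input_def\<close>)

lemma same_trans: "same s s' \<Longrightarrow> same s' s'' \<Longrightarrow> same s s''"
  by (simp add: same_def)

lemma same_ok: "same s (s\<lparr>nvar := (nvar s)(''ok'' := k)\<rparr>)"
  by (simp add: same_def)

abbreviation violated :: "nat set \<Rightarrow> (nat \<Rightarrow> real) \<Rightarrow> nat \<Rightarrow> nat \<Rightarrow> bool" where
  "violated A L a b \<equiv> a \<in> A \<and> b \<in> A \<and> L a < L (mate b) + w {a, b} - mweight b"

lemma dual_iff_check:
  assumes "A \<subseteq> {..<n}" "\<And>x. x \<in> A \<Longrightarrow> 0 \<le> L x"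
  shows "dual A L \<longleftrightarrow> (\<forall>k<m. \<not> (violated A L (u k) (v k) \<or> violated A L (v k) (u k))) \<and>
     (\<forall>x<n. \<not> (x \<in> A \<and> mweight x < L x))" (is "_ \<longleftrightarrow> ?E \<and> ?V")
proof
  assume D: "dual A L"
  then have "\<not> violated A L a b" if "{a, b} \<in> E" for a b
    using that by (fastforce simp: dual_def)
  then have ?E using edge_bounds by (metis insert_commute)
  moreover have ?V using D by (fastforce simp: dual_def)
  ultimately show "?E \<and> ?V" ..
next
  assume EV: "?E \<and> ?V"
  show "dual A L"
    unfolding dual_def
  proof (intro conjI ballI impI)
    fix x assume x: "x \<in> A"
    then show "0 \<le> L x" by (rule assms(2))
    show "L x \<le> mweight x" using EV x assms(1) by force
  next
    fix a b assume ab: "a \<in> A" "b \<in> A" "{a, b} \<in> E"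
    then obtain k where "k < m" "{a, b} = {u k, v k}" using E_eq by auto
    then have "\<not> violated A L a b" using EV by (auto simp: doubleton_eq_iff)
    then show "L (mate b) + w {a, b} - mweight b \<le> L a" using ab by linarith
  qed
qed

lemma runs_check:
  assumes s: "ready s" and L: "\<And>x. x \<in> active s \<Longrightarrow> 0 \<le> rarr s ''L'' x"
    and Q: "\<And>s'. same s s' \<Longrightarrow> nvar s' ''ok'' = (if dual (active s) (rarr s ''L'') then 1 else 0) \<Longrightarrow> Q s'"
  shows "runs check_com s (1 + ((2 + B * (2 + 2)) + (2 + B * (2 + 2)))) Q"
proof -
  let ?A = "active s" and ?L = "rarr s ''L''"
  let ?P1 = "\<lambda>k. \<not> (violated ?A ?L (u k) (v k) \<or> violated ?A ?L (v k) (u k))"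
  let ?P2 = "\<lambda>x. \<not> (x \<in> ?A \<and> mweight x < ?L x)"
  have A: "?A \<subseteq> {..<n}" using covered_subset by (auto simp: active_def)
  let ?s1 = "s\<lparr>nvar := (nvar s)(''ok'' := 1)\<rparr>"
  have s1: "same s ?s1" by (rule same_ok)
  have "runs (For ''k'' (NVar ''m'') (reject_if (bor (violated_exp end1 end2) (violated_exp end2 end1))))
    ?s1 (2 + B * (2 + 2))
    (\<lambda>s'. runs (For ''k'' (NVar ''n'') (reject_if (BAnd (active_exp (NVar ''k''))
          (RLess (RArr ''c'' (NVar ''k'')) (RArr ''L'' (NVar ''k'')))))) s' (2 + B * (2 + 2)) Q)"
  proof (rule runs_reject_loop[where N = m and P = ?P1])
    show "ready ?s1" using same_ready[OF s1 s] .
    then show "nval (NVar ''m'') ?s1 = m" by (simp add: ready_def input_def)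
  next
    fix s' assume s': "same ?s1 s'" "rarr s' ''L'' = rarr ?s1 ''L''" "nvar s' ''k'' < m"
    have same: "same s s'" using same_trans[OF s1 s'(1)] .
    note rdy = same_ready[OF same s]
    show "bval (bor (violated_exp end1 end2) (violated_exp end2 end1)) s' \<longleftrightarrow> \<not> ?P1 (nvar s' ''k'')"
      using bval_violated[OF rdy, of end1 "u (nvar s' ''k'')" end2 "v (nvar s' ''k'')"]
        bval_violated[OF rdy, of end2 "v (nvar s' ''k'')" end1 "u (nvar s' ''k'')"]
        edge_bounds[OF s'(3)] rdy s'(2,3) same_active[OF same]
      by (simp add: ready_def input_def insert_commute)
  next
    fix s2 assume s2: "same ?s1 s2" "rarr s2 ''L'' = rarr ?s1 ''L''"
      "nvar s2 ''ok'' = (if \<forall>k<m. ?P1 k then nvar ?s1 ''ok'' else 0)"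
    have same2: "same s s2" using same_trans[OF s1 s2(1)] .
    show "runs (For ''k'' (NVar ''n'') (reject_if (BAnd (active_exp (NVar ''k''))
          (RLess (RArr ''c'' (NVar ''k'')) (RArr ''L'' (NVar ''k'')))))) s2 (2 + B * (2 + 2)) Q"
    proof (rule runs_reject_loop[where N = n and P = ?P2])
      show "ready s2" using same_ready[OF same2 s] .
      then show "nval (NVar ''n'') s2 = n" by (simp add: ready_def input_def)
    next
      fix s' assume s': "same s2 s'" "rarr s' ''L'' = rarr s2 ''L''" "nvar s' ''k'' < n"
      have same: "same s s'" using same_trans[OF same2 s'(1)] .
      note rdy = same_ready[OF same s]
      show "bval (BAnd (active_exp (NVar ''k'')) (RLess (RArr ''c'' (NVar ''k'')) (RArr ''L'' (NVar ''k'')))) s'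
          \<longleftrightarrow> \<not> ?P2 (nvar s' ''k'')"
        using bval_active[OF rdy, of "NVar ''k''"] rdy s'(2,3) s2(2) same_active[OF same]
        by (simp add: ready_def)
    next
      fix s' assume s': "same s2 s'" "rarr s' ''L'' = rarr s2 ''L''"
        "nvar s' ''ok'' = (if \<forall>x<n. ?P2 x then nvar s2 ''ok'' else 0)"
      define edges_ok where "edges_ok \<longleftrightarrow> (\<forall>k<m. ?P1 k)"
      define vertices_ok where "vertices_ok \<longleftrightarrow> (\<forall>x<n. ?P2 x)"
      have "dual ?A ?L \<longleftrightarrow> edges_ok \<and> vertices_ok"
        unfolding edges_ok_def vertices_ok_def by (rule dual_iff_check[OF A L])
      then have "nvar s' ''ok'' = (if dual ?A ?L then 1 else 0)"
        using s'(3)[folded vertices_ok_def] s2(3)[folded edges_ok_def] by simp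
      then show "Q s'" by (rule Q[OF same_trans[OF same2 s'(1)]])
    qed simp
  qed simp
  then show ?thesis
    unfolding check_com_def by (intro runs_Seq runs_NAssign) simp_all
qed

lemma runs_test:
  assumes s: "ready s"
    and Q: "\<And>s'. same s s' \<Longrightarrow>
      nvar s' ''ok'' = (if good ({nvar s ''a'', nvar s ''b''} \<inter> {..<n}) then 1 else 0) \<Longrightarrow> Q s'"
  shows "runs test_com s (test_time B) Q"
  unfolding test_com_def test_time_def
proof (rule runs_Seq, rule runs_bellman_ford[OF s])
  fix s1 assume s1: "same s s1" "bf (active s) n {} (rarr s1 ''L'')"
  have A: "\<Union>M \<subseteq> active s" "active s \<subseteq> {..<n}" using covered_subset by (auto simp: active_def)
  have act: "active s1 = active s" using same_active[OF s1(1)] .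
  have nonneg: "0 \<le> rarr s1 ''L'' x" if "x \<in> active s1" for x
  proof -
    have "walk (active s) (\<lambda>_. x) 0 0" using that act by (simp add: walk_def)
    then show ?thesis using s1(2) unfolding bf_def by fastforce
  qed
  have good: "dual (active s) (rarr s1 ''L'') \<longleftrightarrow> good ({nvar s ''a'', nvar s ''b''} \<inter> {..<n})"
    using bf_final[OF A] s1(2) unfolding good_def active_def by simp
  show "runs check_com s1 (1 + ((2 + B * (2 + 2)) + (2 + B * (2 + 2)))) Q"
  proof (rule runs_check[OF same_ready[OF s1(1) s] nonneg])
    fix s' assume "same s1 s'"
      "nvar s' ''ok'' = (if dual (active s1) (rarr s1 ''L'') then 1 else 0)"
    then show "Q s'" using Q same_trans[OF s1(1)] unfolding act good by blast
  qed
qed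

definition marks :: "state \<Rightarrow> nat set \<Rightarrow> bool" where
  "marks s S \<longleftrightarrow> (\<forall>x<n. narr s ''S'' x = (if x \<in> S then 1 else 0))"

lemma marks_registers [simp]: "marks (s\<lparr>nvar := f\<rparr>) S \<longleftrightarrow> marks s S"
  by (simp add: marks_def)

lemma ready_registers [simp]:
  "f ''n'' = nvar s ''n'' \<Longrightarrow> f ''m'' = nvar s ''m'' \<Longrightarrow> ready (s\<lparr>nvar := f\<rparr>) \<longleftrightarrow> ready s"
  by (simp add: ready_def input_def)

lemma runs_cover:
  assumes s: "ready s" "marks s S" and ab: "nvar s ''a'' = a" "nvar s ''b'' = b" "a < n"
    and ok: "nvar s ''ok'' = (if good ({a, b} \<inter> {..<n}) then 1 else 0)"
    and Q: "\<And>s'. ready s' \<Longrightarrow> marks s' (if b < n then cover_step a b S else S) \<Longrightarrow>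
      nvar s' = nvar s \<Longrightarrow> Q s'"
  shows "runs cover_com s (1 + (1 + 1)) Q"
proof -
  let ?b = "BAnd (BAnd (NLess (NVar ''ok'') (NConst 1)) (NLess (NVar ''b'') (NVar ''n'')))
       (BAnd (BAnd (exposed_exp (NVar ''a'')) (exposed_exp (NVar ''b'')))
         (BAnd (NLess (NArr ''S'' (NVar ''a'')) (NConst 1)) (NLess (NArr ''S'' (NVar ''b'')) (NConst 1))))"
  have b: "bval ?b s \<longleftrightarrow> b < n \<and> a \<in> {..<n} - \<Union>M - S \<and> b \<in> {..<n} - \<Union>M - S \<and> \<not> good {a, b}"
  proof (cases "b < n")
    case True
    then have "{a, b} \<inter> {..<n} = {a, b}" using ab by auto
    then show ?thesis
      using True s ab ok bval_exposed[OF s(1), of "NVar ''a''"] bval_exposed[OF s(1), of "NVar ''b''"]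
      by (auto simp: marks_def ready_def input_def simp del: Union_iff)
  next
    case False
    then show ?thesis using ab s by (simp add: ready_def input_def)
  qed
  show ?thesis
    unfolding cover_com_def
  proof (rule runs_Cond)
    assume "bval ?b s"
    then have step: "(if b < n then cover_step a b S else S) = insert a (insert b S)"
      unfolding b cover_step_def by simp
    show "runs (Seq (NStore ''S'' (NVar ''a'') (NConst 1)) (NStore ''S'' (NVar ''b'') (NConst 1))) s (1 + 1) Q"
      by (intro runs_Seq runs_NStore Q, unfold step)
        (use s ab in \<open>auto simp: ready_def input_def marks_def\<close>)
  next
    assume "\<not> bval ?b s"
    then have step: "(if b < n then cover_step a b S else S) = S"
      unfolding b cover_step_def by auto
    show "runs Skip s (1 + 1) Q"
      by (intro runs_Skip Q, unfold step) (use s in simp_all)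
  qed
qed

lemma runs_init:
  assumes s: "input s" "\<And>x. rarr s ''c'' x = 0" "\<And>x. narr s ''S'' x = 0"
    and Q: "\<And>s'. ready s' \<Longrightarrow> marks s' {} \<Longrightarrow> Q s'"
  shows "runs init_com s ((2 + B * (1 + 2)) + (2 + B * ((1 + ((1 + 1) + (1 + 1))) + 2))) Q"
  unfolding init_com_def
proof (rule runs_Seq, rule runs_For[where N = n and I = "\<lambda>i s'. input s' \<and>
    (\<forall>x. rarr s' ''c'' x = 0 \<and> narr s' ''S'' x = 0) \<and> (\<forall>x<i. narr s' ''mate'' x = x)"])
  fix i s' assume I: "input s' \<and> (\<forall>x. rarr s' ''c'' x = 0 \<and> narr s' ''S'' x = 0) \<and>
    (\<forall>x<i. narr s' ''mate'' x = x)" "nvar s' ''k'' = i"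
  show "runs (NStore ''mate'' (NVar ''k'') (NVar ''k'')) s' 1 (\<lambda>s'. nvar s' ''k'' = i \<and>
     input (s'\<lparr>nvar := (nvar s')(''k'' := Suc i)\<rparr>) \<and>
     (\<forall>x. rarr (s'\<lparr>nvar := (nvar s')(''k'' := Suc i)\<rparr>) ''c'' x = 0 \<and>
        narr (s'\<lparr>nvar := (nvar s')(''k'' := Suc i)\<rparr>) ''S'' x = 0) \<and>
     (\<forall>x<Suc i. narr (s'\<lparr>nvar := (nvar s')(''k'' := Suc i)\<rparr>) ''mate'' x = x))"
    by (rule runs_NStore) (use I in \<open>simp_all add: input_def less_Suc_eq\<close>)
next
  let ?seen = "\<lambda>k x. \<exists>j<k. {u j, v j} \<in> M \<and> x \<in> {u j, v j}"
  let ?I = "\<lambda>k s'. input s' \<and> (\<forall>x. narr s' ''S'' x = 0) \<and>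
    (\<forall>x<n. narr s' ''mate'' x = (if ?seen k x then mate x else x) \<and>
       rarr s' ''c'' x = (if ?seen k x then mweight x else 0))"
  let ?c = "Cond (NLess (NConst 0) (NArr ''M'' (NVar ''k'')))
        (Seq (Seq (NStore ''mate'' end1 end2) (NStore ''mate'' end2 end1))
          (Seq (RStore ''c'' end1 (RArr ''w'' (NVar ''k''))) (RStore ''c'' end2 (RArr ''w'' (NVar ''k'')))))
        Skip"
  fix s1 assume s1: "input s1 \<and> (\<forall>x. rarr s1 ''c'' x = 0 \<and> narr s1 ''S'' x = 0) \<and>
    (\<forall>x<n. narr s1 ''mate'' x = x)"
  show "runs (For ''k'' (NVar ''m'') ?c) s1 (2 + B * ((1 + ((1 + 1) + (1 + 1))) + 2)) Q"
  proof (rule runs_For[where N = m and I = ?I])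
    fix k s' assume k: "k < m" and I: "?I k s'" and ks: "nvar s' ''k'' = k"
    have inp: "narr s' ''u'' k = u k" "narr s' ''v'' k = v k" "rarr s' ''w'' k = w {u k, v k}"
      "narr s' ''M'' k = (if {u k, v k} \<in> M then 1 else 0)"
      using I k by (auto simp: input_def)
    have seen_Suc: "?seen (Suc k) x \<longleftrightarrow> ?seen k x \<or> ({u k, v k} \<in> M \<and> x \<in> {u k, v k})" for x
      by (auto simp: less_Suc_eq)
    show "runs ?c s' (1 + ((1 + 1) + (1 + 1)))
      (\<lambda>s'. nvar s' ''k'' = k \<and> ?I (Suc k) (s'\<lparr>nvar := (nvar s')(''k'' := Suc k)\<rparr>))"
    proof (rule runs_Cond)
      assume "bval (NLess (NConst 0) (NArr ''M'' (NVar ''k''))) s'"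
      then have uvM: "{u k, v k} \<in> M" using inp ks by (simp split: if_splits)
      then have vuM: "{v k, u k} \<in> M" by (simp add: insert_commute)
      note facts = mate_eq[OF uvM] mate_eq[OF vuM] mweight_eq[OF uvM] mweight_eq[OF vuM]
      let ?r1 = "s'\<lparr>narr := (narr s')(''mate'' := (narr s' ''mate'')(u k := v k, v k := u k))\<rparr>"
      let ?r2 = "?r1\<lparr>rarr := (rarr s')(''c'' := (rarr s' ''c'')(u k := w {u k, v k}, v k := w {u k, v k}))\<rparr>"
      have "?I (Suc k) (?r2\<lparr>nvar := (nvar ?r2)(''k'' := Suc k)\<rparr>)"
        unfolding seen_Suc using I uvM facts by (auto simp: input_def insert_commute)
      then show "runs (Seq (Seq (NStore ''mate'' end1 end2) (NStore ''mate'' end2 end1))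
          (Seq (RStore ''c'' end1 (RArr ''w'' (NVar ''k''))) (RStore ''c'' end2 (RArr ''w'' (NVar ''k'')))))
          s' ((1 + 1) + (1 + 1)) (\<lambda>s'. nvar s' ''k'' = k \<and> ?I (Suc k) (s'\<lparr>nvar := (nvar s')(''k'' := Suc k)\<rparr>))"
        by (intro runs_Seq runs_NStore runs_RStore) (use ks inp in simp_all)
    next
      assume "\<not> bval (NLess (NConst 0) (NArr ''M'' (NVar ''k''))) s'"
      then have "{u k, v k} \<notin> M" using inp ks by (simp split: if_splits)
      then have "?I (Suc k) (s'\<lparr>nvar := (nvar s')(''k'' := Suc k)\<rparr>)"
        unfolding seen_Suc using I by (auto simp: input_def)
      then show "runs Skip s' ((1 + 1) + (1 + 1))
          (\<lambda>s'. nvar s' ''k'' = k \<and> ?I (Suc k) (s'\<lparr>nvar := (nvar s')(''k'' := Suc k)\<rparr>))"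
        by (intro runs_Skip) (use ks in simp_all)
    qed
  next
    fix s' assume I: "?I m s'"
    have seen: "?seen m x \<longleftrightarrow> x \<in> \<Union>M" for x
    proof
      assume "x \<in> \<Union>M"
      then obtain e where e: "e \<in> M" "x \<in> e" by blast
      then obtain k where "k < m" "e = {u k, v k}" using M_subset E_eq by blast
      then show "?seen m x" using e by blast
    qed blast
    show "Q s'"
      by (rule Q) (use I in \<open>auto simp only: seen ready_def marks_def mate_exposed mweight_exposed
         split: if_splits\<close>)
  qed (use s1 size in \<open>simp_all add: input_def\<close>)
qed (use s size in \<open>simp_all add: input_def\<close>)

definition pairs :: "nat \<Rightarrow> nat \<Rightarrow> (nat \<times> nat) set" where
  "pairs d i = {(a, b). a \<le> b \<and> b < n \<and> (b - a < d \<or> b - a = d \<and> a < i)}"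

lemma pairs_Suc: "pairs d (Suc i) = (if i + d < n then insert (i, i + d) (pairs d i) else pairs d i)"
  by (auto simp: pairs_def)

lemma pairs_round: "pairs d n = pairs (Suc d) 0"
  by (auto simp: pairs_def)

lemma runs_stabilizer:
  assumes s: "input s" "\<And>x. rarr s ''c'' x = 0" "\<And>x. narr s ''S'' x = 0"
    and Q: "\<And>s' S. marks s' S \<Longrightarrow> covering (pairs n 0) S \<Longrightarrow>
      nvar s' ''ok'' = (if good {} then 1 else 0) \<Longrightarrow> Q s'"
  shows "runs stabilizer_com s (stabilizer_time B) Q"
  unfolding stabilizer_com_def stabilizer_time_def
proof (rule runs_Seq, rule runs_init[OF s], rule runs_Seq)
  let ?I = "\<lambda>d i s'. ready s' \<and> nvar s' ''d'' = d \<and> (\<exists>S. marks s' S \<and> covering (pairs d i) S)"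
  let ?body = "Seq (Seq (NAssign ''a'' (NVar ''i'')) (NAssign ''b'' (NPlus (NVar ''i'') (NVar ''d''))))
           (Seq test_com cover_com)"
  fix s1 assume s1: "ready s1" "marks s1 {}"
  have body: "runs ?body s' ((1 + 1) + (test_time B + (1 + (1 + 1))))
      (\<lambda>s'. nvar s' ''i'' = i \<and> ?I d (Suc i) (s'\<lparr>nvar := (nvar s')(''i'' := Suc i)\<rparr>))"
    if I: "?I d i s'" "nvar s' ''i'' = i" "i < n" "d < n" for s' d i
  proof -
    let ?s = "s'\<lparr>nvar := (nvar s')(''a'' := i, ''b'' := i + d)\<rparr>"
    obtain S where S: "marks s' S" "covering (pairs d i) S" using I by blast
    have rdy: "ready ?s" using I by (simp add: ready_def input_def)
    let ?S = "if i + d < n then cover_step i (i + d) S else S"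
    have "covering (pairs d (Suc i)) ?S"
    proof (cases "i + d < n")
      case True
      then have "(i, i) \<in> pairs d i \<and> (i + d, i + d) \<in> pairs d i" if "i \<noteq> i + d"
        using that by (simp add: pairs_def)
      then show ?thesis using covering_step[OF S(2), of i "i + d"] True by (simp add: pairs_Suc)
    qed (use S in \<open>simp add: pairs_Suc\<close>)
    then have inv: "?I d (Suc i) (t\<lparr>nvar := (nvar t)(''i'' := Suc i)\<rparr>)"
      if "ready t" "marks t ?S" "nvar t ''d'' = d" for t
      using that by (intro conjI exI[of _ ?S]) simp_all
    have "runs test_com ?s (test_time B) (\<lambda>s'. runs cover_com s' (1 + (1 + 1))
      (\<lambda>s'. nvar s' ''i'' = i \<and> ?I d (Suc i) (s'\<lparr>nvar := (nvar s')(''i'' := Suc i)\<rparr>)))"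
    proof (rule runs_test[OF rdy])
      fix t assume t: "same ?s t"
        "nvar t ''ok'' = (if good ({nvar ?s ''a'', nvar ?s ''b''} \<inter> {..<n}) then 1 else 0)"
      have reg: "nvar t ''a'' = i" "nvar t ''b'' = i + d" "nvar t ''i'' = i" "nvar t ''d'' = d"
        and "narr t = narr s'"
        using t(1) I by (simp_all add: same_def)
      then have "marks t S" using S by (simp add: marks_def)
      then show "runs cover_com t (1 + (1 + 1))
        (\<lambda>s'. nvar s' ''i'' = i \<and> ?I d (Suc i) (s'\<lparr>nvar := (nvar s')(''i'' := Suc i)\<rparr>))"
      proof (rule runs_cover[OF same_ready[OF t(1) rdy] _ reg(1,2) I(3)])
        show "nvar t ''ok'' = (if good ({i, i + d} \<inter> {..<n}) then 1 else 0)" using t(2) by simp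
      next
        fix r assume r: "ready r" "marks r ?S" "nvar r = nvar t"
        have "nvar r ''i'' = i" "nvar r ''d'' = d" using r(3) reg by simp_all
        then show "nvar r ''i'' = i \<and> ?I d (Suc i) (r\<lparr>nvar := (nvar r)(''i'' := Suc i)\<rparr>)"
          using inv[OF r(1,2)] by blast
      qed
    qed
    moreover have "s'\<lparr>nvar := (nvar s')(''a'' := i)\<rparr>\<lparr>nvar :=
        (nvar (s'\<lparr>nvar := (nvar s')(''a'' := i)\<rparr>))(''b'' := i + d)\<rparr> = ?s" by simp
    ultimately show ?thesis
      by (intro runs_Seq runs_NAssign) (use I in simp_all)
  qed
  show "runs (For ''d'' (NVar ''n'') (For ''i'' (NVar ''n'') ?body)) s1
     (2 + B * ((2 + B * (((1 + 1) + (test_time B + (1 + (1 + 1)))) + 2)) + 2))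
     (\<lambda>s'. runs (Seq (Seq (NAssign ''a'' (NVar ''n'')) (NAssign ''b'' (NVar ''n''))) test_com) s'
        ((1 + 1) + test_time B) Q)"
  proof (rule runs_For[where N = n and I = "\<lambda>d s'. ready s' \<and> (\<exists>S. marks s' S \<and> covering (pairs d 0) S)"])
    fix d s' assume d: "d < n" "nvar s' ''d'' = d"
      and I: "ready s' \<and> (\<exists>S. marks s' S \<and> covering (pairs d 0) S)"
    show "runs (For ''i'' (NVar ''n'') ?body) s'
       (2 + B * (((1 + 1) + (test_time B + (1 + (1 + 1)))) + 2))
       (\<lambda>s'. nvar s' ''d'' = d \<and> ready (s'\<lparr>nvar := (nvar s')(''d'' := Suc d)\<rparr>) \<and>
          (\<exists>S. marks (s'\<lparr>nvar := (nvar s')(''d'' := Suc d)\<rparr>) S \<and> covering (pairs (Suc d) 0) S))"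
    proof (rule runs_For[where N = n and I = "?I d"])
      fix i t assume "i < n" "?I d i t" "nvar t ''i'' = i"
      then show "runs ?body t ((1 + 1) + (test_time B + (1 + (1 + 1))))
         (\<lambda>s'. nvar s' ''i'' = i \<and> ?I d (Suc i) (s'\<lparr>nvar := (nvar s')(''i'' := Suc i)\<rparr>))"
        using body d(1) by blast
    next
      fix i t assume "?I d i t"
      then show "nval (NVar ''n'') t = n" by (simp add: ready_def input_def)
    qed (use I d size in \<open>simp_all add: pairs_round\<close>)
  next
    fix s' assume I: "ready s' \<and> (\<exists>S. marks s' S \<and> covering (pairs n 0) S)"
    then obtain S where S: "marks s' S" "covering (pairs n 0) S" by blast
    let ?s = "s'\<lparr>nvar := (nvar s')(''a'' := n, ''b'' := n)\<rparr>"
    have "ready ?s" using I by (simp add: ready_def input_def)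
    then have "runs test_com ?s (test_time B) Q"
    proof (rule runs_test)
      fix t assume t: "same ?s t"
        "nvar t ''ok'' = (if good ({nvar ?s ''a'', nvar ?s ''b''} \<inter> {..<n}) then 1 else 0)"
      then have "marks t S" using S by (simp add: marks_def same_def)
      moreover have "nvar t ''ok'' = (if good {} then 1 else 0)" using t(2) by simp
      ultimately show "Q t" using Q S(2) by blast
    qed
    then show "runs (Seq (Seq (NAssign ''a'' (NVar ''n'')) (NAssign ''b'' (NVar ''n''))) test_com) s'
        ((1 + 1) + test_time B) Q"
      by (intro runs_Seq runs_NAssign) (use I in \<open>simp_all add: ready_def input_def\<close>)
  next
    have "pairs 0 0 = {}" by (simp add: pairs_def)
    then show "ready (s1\<lparr>nvar := (nvar s1)(''d'' := 0)\<rparr>) \<and>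
       (\<exists>S. marks (s1\<lparr>nvar := (nvar s1)(''d'' := 0)\<rparr>) S \<and> covering (pairs 0 0) S)"
      using s1 covering_init by auto
  next
    fix d s' assume "ready s' \<and> (\<exists>S. marks s' S \<and> covering (pairs d 0) S)"
    then show "nval (NVar ''n'') s' = n" by (simp add: ready_def input_def)
  qed (use size in simp)
qed

end

lemma stabilizer_com_correct:
  assumes "\<And>n E w M S. weighted_matching {..<n} E w M \<Longrightarrow> P {..<n} E w M \<Longrightarrow>
    approx_stabilizer 2 {..<n} E w M S \<Longrightarrow>
    (max_weight_matching E w M \<Longrightarrow> min_stabilizer {..<n} E w M S) \<Longrightarrow> Q {..<n} E w M S"
  shows "poly_time_algorithm P Q stabilizer_com"
  unfolding poly_time_algorithm_def
proof (intro exI[of _ "stabilizer_time [:0, 1:]"] allI impI, elim conjE)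
  fix n E w M s
  assume inst: "stabilizer_instance {..<n} E w M" and P: "P {..<n} E w M" and enc: "encodes s n E w M"
  let ?m = "card E" and ?u = "narr s ''u''" and ?v = "narr s ''v''"
  obtain e where e: "bij_betw e {..<?m} E" "\<forall>k<?m. e k = {?u k, ?v k} \<and> rarr s ''w'' k = w (e k) \<and>
      narr s ''M'' k = (if e k \<in> M then 1 else 0)"
    using enc unfolding encodes_def by (elim conjE exE) (rule that)
  have E: "E = (\<lambda>k. {?u k, ?v k}) ` {..<?m}"
    using bij_betw_imp_surj_on[OF e(1)] e(2) by (metis (no_types, lifting) image_cong lessThan_iff)
  interpret encoded_matching n E w M ?u ?v ?m "n + ?m"
    by unfold_locales (use inst E in simp_all)
  have "runs stabilizer_com s (stabilizer_time (n + ?m))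
    (\<lambda>s'. if \<exists>S. vertex_stabilizer {..<n} E w M S
       then nvar s' ''ok'' = 1 \<and> Q {..<n} E w M (output_set n s') else nvar s' ''ok'' = 0)"
  proof (rule runs_stabilizer)
    have "nvar s = (\<lambda>_. 0)(''n'' := n, ''m'' := ?m)" using enc by (simp add: encodes_def)
    then show "input s" using e(2) by (simp add: input_def)
  next
    fix s' S assume S: "marks s' S" "covering (pairs n 0) S" "nvar s' ''ok'' = (if good {} then 1 else 0)"
    have "output_set n s' = S"
      using S(1,2) by (auto simp: output_set_def marks_def covering_def split: if_splits)
    moreover have "Q {..<n} E w M S" if "good {}"
    proof -
      have all: "(a, b) \<in> pairs n 0 \<or> (b, a) \<in> pairs n 0" if "a \<in> {..<n}" "b \<in> {..<n}" for a b
        using that by (auto simp: pairs_def)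
      note fin = covering_final[OF S(2) that all]
      show ?thesis by (rule assms[OF weighted_matching_axioms P fin])
    qed
    ultimately show "if \<exists>S. vertex_stabilizer {..<n} E w M S
       then nvar s' ''ok'' = 1 \<and> Q {..<n} E w M (output_set n s') else nvar s' ''ok'' = 0"
      using S(3) unfolding stabilizer_exists_iff by simp
  qed (use enc in \<open>simp_all add: encodes_def\<close>)
  then show "\<exists>t s'. exec stabilizer_com s t s' \<and> t \<le> poly (stabilizer_time [:0, 1:]) (n + card E) \<and>
     (if \<exists>S. vertex_stabilizer {..<n} E w M S
      then nvar s' ''ok'' = 1 \<and> Q {..<n} E w M (output_set n s') else nvar s' ''ok'' = 0)"
    unfolding runs_def poly_stabilizer_time .
qed

theorem theorem12:
  "(\<exists>c. poly_time_algorithm (\<lambda>V E w M. True) (approx_stabilizer 2) c) \<and>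
   (\<exists>c. poly_time_algorithm (\<lambda>V E w M. max_weight_matching E w M) min_stabilizer c)"
proof
  show "\<exists>c. poly_time_algorithm (\<lambda>V E w M. True) (approx_stabilizer 2) c"
    by (rule exI, rule stabilizer_com_correct)
  show "\<exists>c. poly_time_algorithm (\<lambda>V E w M. max_weight_matching E w M) min_stabilizer c"
    by (rule exI, rule stabilizer_com_correct)
qed

end
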